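(* Let $a<0$, $c<0$, $a_2>0$, $c_2>0$, $b>0$, $b_2>0$, let $0<|\omega|<\min\left\{1,\frac{-a}{b},\frac{-c}{b},\frac{a_2}{b_2},\frac{c_2}{b_2}\right\}$, and let $F:\mathbb{R}^4\to\mathbb{R}$ be $C^2$ with $F(0)=0$ satisfying conditions (a), (b), (c) of the context. Let $(\psi_0,v_0)\in X$ satisfy $P_\omega(\psi_0,v_0)=0$ and $J_\omega(\psi_0,v_0)=S(\omega)$. Then $(\psi_0,v_0)$ is a weak solution of the traveling-wave system, i.e. $J_\omega'(\psi_0,v_0)=0$ in the dual of $X$.
   Context: $X=H^2(\mathbb{R})\times H^2(\mathbb{R})$. For $(\psi,v)\in X$: $I_1(\psi,v)=\int_{\mathbb R}[\psi^2-c(\psi')^2+c_2(\psi'')^2+v^2-a(v')^2+a_2(v'')^2]\,dx$, $I_2(\psi,v)=\int_{\mathbb R}(\psi v+b\psi'v'+b_2\psi''v'')\,dx$, $I_\omega=I_1-2\omega I_2$. $F:\mathbb{R}^4\to\mathbb{R}$ is $C^2$, $F(0)=0$, $G(w)=w\cdot\nabla F(w)$. Conditions: (a) there is $p>0$ with $w\cdot\nabla G(w)\ge(p+2)G(w)$ for all $w\in\mathbb{R}^4$; (b) there exist $0<q_1\le q_2<\infty$, $C>0$ with $|D^2F(w)|\le C(|w|^{q_1}+|w|^{q_2})$; (c) there exist $u,v\in H^2(\mathbb{R})$ with $\int_{\mathbb R}F(u,u',v,v')\,dx>0$. $K(\psi,v)=\int F(\psi,\psi',v,v')\,dx$, $N(\psi,v)=\int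 G(\psi,\psi',v,v')\,dx$, $J_\omega=\tfrac12I_\omega-K$, $P_\omega=I_\omega-N$, $\mathcal M_\omega=\{P_\omega=0\}$, $S(\omega)=\inf\{J_\omega(\psi,v):(\psi,v)\in\mathcal M_\omega\setminus\{0\}\}$. Weak solutions of the traveling-wave equations of the higher-order Boussinesq system (with $b=d$, $b_2=d_2$) are, by definition, critical points of $J_\omega$ on $X$. *)

theory Defs
  imports "HOL-Analysis.Analysis"
begin

text \<open>Test functions: continuously differentiable with compact support
  (weak derivatives tested against C^1_c functions; equivalent to C^\<infinity>_c testing).\<close>
definition test_fun :: "(real \<Rightarrow> real) \<Rightarrow> bool" where
  "test_fun \<phi> \<longleftrightarrow> \<phi> C1_differentiable_on UNIV \<and> bounded {x. \<phi> x \<noteq> 0}"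

definition loc_integrable :: "(real \<Rightarrow> real) \<Rightarrow> bool" where
  "loc_integrable u \<longleftrightarrow> (\<forall>r s. set_integrable lborel {r..s} u)"

definition weak_deriv :: "(real \<Rightarrow> real) \<Rightarrow> (real \<Rightarrow> real) \<Rightarrow> bool" where
  "weak_deriv u u' \<longleftrightarrow> loc_integrable u \<and> loc_integrable u' \<and>
     (\<forall>\<phi>. test_fun \<phi> \<longrightarrow>
        (LINT x|lborel. u x * deriv \<phi> x) = - (LINT x|lborel. u' x * \<phi> x))"

definition sq_int :: "(real \<Rightarrow> real) \<Rightarrow> bool" where
  "sq_int f \<longleftrightarrow> f \<in> borel_measurable lborel \<and> integrable lborel (\<lambda>x. (f x)\<^sup>2)"

definition H2 :: "(real \<Rightarrow> real) \<Rightarrow> bool" where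
  "H2 u \<longleftrightarrow> (\<exists>u1 u2. sq_int u \<and> sq_int u1 \<and> sq_int u2 \<and> weak_deriv u u1 \<and> weak_deriv u1 u2)"

text \<open>A chosen weak derivative (determined up to a.e. equality).\<close>
definition wd :: "(real \<Rightarrow> real) \<Rightarrow> (real \<Rightarrow> real)" where
  "wd u = (SOME u'. weak_deriv u u')"

definition H2_norm_sq :: "(real \<Rightarrow> real) \<Rightarrow> real" where
  "H2_norm_sq u = (LINT x|lborel. (u x)\<^sup>2 + (wd u x)\<^sup>2 + (wd (wd u) x)\<^sup>2)"

definition X_norm :: "(real \<Rightarrow> real) \<Rightarrow> (real \<Rightarrow> real) \<Rightarrow> real" where
  "X_norm \<psi> v = sqrt (H2_norm_sq \<psi> + H2_norm_sq v)"

text \<open>Zero element of X (functions equal a.e. are identified).\<close>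
definition X_zero :: "(real \<Rightarrow> real) \<Rightarrow> (real \<Rightarrow> real) \<Rightarrow> bool" where
  "X_zero \<psi> v \<longleftrightarrow> (AE x in lborel. \<psi> x = 0 \<and> v x = 0)"

definition vec4 :: "real \<Rightarrow> real \<Rightarrow> real \<Rightarrow> real \<Rightarrow> real^4" where
  "vec4 x1 x2 x3 x4 = vector [x1, x2, x3, x4]"

definition grad :: "(real^4 \<Rightarrow> real) \<Rightarrow> real^4 \<Rightarrow> real^4" where
  "grad F w = (\<chi> i. frechet_derivative F (at w) (axis i 1))"

definition hess :: "(real^4 \<Rightarrow> real) \<Rightarrow> real^4 \<Rightarrow> real^4^4" where
  "hess F w = jacobian (grad F) (at w)"

definition C2_R4 :: "(real^4 \<Rightarrow> real) \<Rightarrow> bool" where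
  "C2_R4 F \<longleftrightarrow> (\<forall>w. F differentiable (at w)) \<and> (\<forall>w. grad F differentiable (at w))
     \<and> continuous_on UNIV (hess F)"

definition Gfun :: "(real^4 \<Rightarrow> real) \<Rightarrow> real^4 \<Rightarrow> real" where
  "Gfun F w = w \<bullet> grad F w"

definition I1 :: "real \<Rightarrow> real \<Rightarrow> real \<Rightarrow> real \<Rightarrow> (real \<Rightarrow> real) \<Rightarrow> (real \<Rightarrow> real) \<Rightarrow> real" where
  "I1 a a2 c c2 \<psi> v = (LINT x|lborel. (\<psi> x)\<^sup>2 - c * (wd \<psi> x)\<^sup>2 + c2 * (wd (wd \<psi>) x)\<^sup>2
      + (v x)\<^sup>2 - a * (wd v x)\<^sup>2 + a2 * (wd (wd v) x)\<^sup>2)"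

definition I2 :: "real \<Rightarrow> real \<Rightarrow> (real \<Rightarrow> real) \<Rightarrow> (real \<Rightarrow> real) \<Rightarrow> real" where
  "I2 b b2 \<psi> v = (LINT x|lborel. \<psi> x * v x + b * wd \<psi> x * wd v x + b2 * wd (wd \<psi>) x * wd (wd v) x)"

definition Iw :: "real \<Rightarrow> real \<Rightarrow> real \<Rightarrow> real \<Rightarrow> real \<Rightarrow> real \<Rightarrow> real \<Rightarrow> (real \<Rightarrow> real) \<Rightarrow> (real \<Rightarrow> real) \<Rightarrow> real" where
  "Iw a a2 c c2 b b2 \<omega> \<psi> v = I1 a a2 c c2 \<psi> v - 2 * \<omega> * I2 b b2 \<psi> v"

definition Kfun :: "(real^4 \<Rightarrow> real) \<Rightarrow> (real \<Rightarrow> real) \<Rightarrow> (real \<Rightarrow> real) \<Rightarrow> real" where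
  "Kfun F \<psi> v = (LINT x|lborel. F (vec4 (\<psi> x) (wd \<psi> x) (v x) (wd v x)))"

definition Nfun :: "(real^4 \<Rightarrow> real) \<Rightarrow> (real \<Rightarrow> real) \<Rightarrow> (real \<Rightarrow> real) \<Rightarrow> real" where
  "Nfun F \<psi> v = (LINT x|lborel. Gfun F (vec4 (\<psi> x) (wd \<psi> x) (v x) (wd v x)))"

definition Jw where
  "Jw a a2 c c2 b b2 \<omega> F \<psi> v = Iw a a2 c c2 b b2 \<omega> \<psi> v / 2 - Kfun F \<psi> v"

definition Pw where
  "Pw a a2 c c2 b b2 \<omega> F \<psi> v = Iw a a2 c c2 b b2 \<omega> \<psi> v - Nfun F \<psi> v"

definition Sw where
  "Sw a a2 c c2 b b2 \<omega> F = Inf {Jw a a2 c c2 b b2 \<omega> F \<psi> v | \<psi> v.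
      H2 \<psi> \<and> H2 v \<and> Pw a a2 c c2 b b2 \<omega> F \<psi> v = 0 \<and> \<not> X_zero \<psi> v}"

definition Jw_critical where
  "Jw_critical a a2 c c2 b b2 \<omega> F \<psi>0 v0 \<longleftrightarrow>
     (\<forall>\<epsilon>>0. \<exists>\<delta>>0. \<forall>h k. H2 h \<and> H2 k \<and> X_norm h k < \<delta> \<longrightarrow>
        \<bar>Jw a a2 c c2 b b2 \<omega> F (\<lambda>x. \<psi>0 x + h x) (\<lambda>x. v0 x + k x) - Jw a a2 c c2 b b2 \<omega> F \<psi>0 v0\<bar>
          \<le> \<epsilon> * X_norm h k)"

end

(* On the Nehari manifold P = 0, condition (a) gives G(tw) >= t^(p+2) G(w) for t >= 1. Hence on the
   ray through a nonzero z with P(z) = 0 the sign of P changes from + to - at z, and J restricted to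
   the ray is maximal at z; moreover J >= 0 on the manifold. If J'(z) were negative in a direction y,
   then for small s > 0 the intermediate value theorem would yield t close to 1 with
   P(t(z + s y)) = 0, and J(t(z + s y)) < J(t z) <= J(z), contradicting minimality. So no Lagrange
   multiplier is needed. J is differentiable on X because functions in H^1 of the line are
   essentially bounded, so that the Lipschitz bounds for the gradient of F on balls suffice. *)

theory Submission
  imports Defs
begin

section \<open>Square-integrable functions\<close>

definition square_integrable :: "'m measure \<Rightarrow> ('m \<Rightarrow> 'a::euclidean_space) \<Rightarrow> bool" where
  "square_integrable M f \<longleftrightarrow> f \<in> borel_measurable M \<and> integrable M (\<lambda>x. (norm (f x))\<^sup>2)"

lemma sq_int_iff_square_integrable: "sq_int f \<longleftrightarrow> square_integrable lborel f"
  by (simp add: sq_int_def square_integrable_def)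

lemma square_integrable_borel [measurable_dest]: "square_integrable M f \<Longrightarrow> f \<in> borel_measurable M"
  by (simp add: square_integrable_def)

lemma square_integrable_norm_sq: "square_integrable M f \<Longrightarrow> integrable M (\<lambda>x. (norm (f x))\<^sup>2)"
  by (simp add: square_integrable_def)

lemma norm_add_sq_le: "(norm (x + y))\<^sup>2 \<le> 2 * (norm x)\<^sup>2 + 2 * (norm y)\<^sup>2"
  for x y :: "'a::real_normed_vector"
proof -
  have "(norm (x + y))\<^sup>2 \<le> (norm x + norm y)\<^sup>2"
    by (intro power_mono norm_triangle_ineq) simp
  also have "\<dots> \<le> 2 * (norm x)\<^sup>2 + 2 * (norm y)\<^sup>2"
    using zero_le_power2[of "norm x - norm y"] by (simp add: power2_eq_square algebra_simps)
  finally show ?thesis .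
qed

lemma square_integrable_lincomb:
  assumes "square_integrable M f" "square_integrable M g"
  shows "square_integrable M (\<lambda>x. \<alpha> *\<^sub>R f x + \<beta> *\<^sub>R g x)"
proof -
  note [measurable] = square_integrable_borel[OF assms(1)] square_integrable_borel[OF assms(2)]
  have "integrable M (\<lambda>x. (norm (\<alpha> *\<^sub>R f x + \<beta> *\<^sub>R g x))\<^sup>2)"
  proof (rule Bochner_Integration.integrable_bound)
    show "integrable M (\<lambda>x. 2 * (\<alpha>\<^sup>2 * (norm (f x))\<^sup>2) + 2 * (\<beta>\<^sup>2 * (norm (g x))\<^sup>2))"
      using assms by (simp add: square_integrable_norm_sq)
    show "AE x in M. norm ((norm (\<alpha> *\<^sub>R f x + \<beta> *\<^sub>R g x))\<^sup>2)
        \<le> norm (2 * (\<alpha>\<^sup>2 * (norm (f x))\<^sup>2) + 2 * (\<beta>\<^sup>2 * (norm (g x))\<^sup>2))"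
    proof (rule AE_I2)
      fix x
      show "norm ((norm (\<alpha> *\<^sub>R f x + \<beta> *\<^sub>R g x))\<^sup>2)
          \<le> norm (2 * (\<alpha>\<^sup>2 * (norm (f x))\<^sup>2) + 2 * (\<beta>\<^sup>2 * (norm (g x))\<^sup>2))"
        using norm_add_sq_le[of "\<alpha> *\<^sub>R f x" "\<beta> *\<^sub>R g x"] by (simp add: power_mult_distrib)
    qed
  qed measurable
  then show ?thesis
    by (simp add: square_integrable_def)
qed

lemma square_integrable_Pair:
  assumes "square_integrable M f" "square_integrable M g"
  shows "square_integrable M (\<lambda>x. (f x, g x))"
  using assms by (auto simp: square_integrable_def norm_Pair intro: borel_measurable_Pair)

lemma square_integrable_fst:
  assumes "square_integrable M f"
  shows "square_integrable M (\<lambda>x. fst (f x))"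
proof -
  have [measurable]: "(\<lambda>x. fst (f x)) \<in> borel_measurable M"
    using square_integrable_borel[OF assms]
    by (rule borel_measurable_continuous_on[rotated]) (intro continuous_intros)
  have "integrable M (\<lambda>x. (norm (fst (f x)))\<^sup>2)"
  proof (rule Bochner_Integration.integrable_bound[OF square_integrable_norm_sq[OF assms]])
    have "norm (fst (f x)) \<le> norm (f x)" for x
      using norm_fst_le[of "fst (f x)" "snd (f x)"] by simp
    then show "AE x in M. norm ((norm (fst (f x)))\<^sup>2) \<le> norm ((norm (f x))\<^sup>2)"
      by (intro AE_I2) (simp add: power_mono)
  qed measurable
  then show ?thesis
    by (simp add: square_integrable_def)
qed

lemma square_integrable_cong_AE:
  assumes "square_integrable M f" "AE x in M. g x = f x" "g \<in> borel_measurable M"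
  shows "square_integrable M g"
  unfolding square_integrable_def
proof (intro conjI assms(3))
  note [measurable] = assms(3)
  show "integrable M (\<lambda>x. (norm (g x))\<^sup>2)"
  proof (rule integrable_cong_AE_imp[OF square_integrable_norm_sq[OF assms(1)]])
    show "AE x in M. (norm (f x))\<^sup>2 = (norm (g x))\<^sup>2"
      using assms(2) by eventually_elim simp
  qed measurable
qed

lemma integrable_bounded_bilinear:
  fixes B :: "'a::euclidean_space \<Rightarrow> 'b::euclidean_space \<Rightarrow> 'c::{banach, second_countable_topology}"
  assumes B: "bounded_bilinear B" and f: "square_integrable M f" and g: "square_integrable M g"
  shows "integrable M (\<lambda>x. B (f x) (g x))"
proof -
  obtain K where B_le: "K > 0" "\<And>u v. norm (B u v) \<le> norm u * norm v * K"
    using bounded_bilinear.pos_bounded[OF B] by blast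
  show ?thesis
  proof (rule Bochner_Integration.integrable_bound)
    show "integrable M (\<lambda>x. K * ((norm (f x))\<^sup>2 + (norm (g x))\<^sup>2))"
      using f g by (simp add: square_integrable_norm_sq)
    show "(\<lambda>x. B (f x) (g x)) \<in> borel_measurable M"
      using f g
      by (intro borel_measurable_continuous_Pair[where H=B] bounded_bilinear.continuous_on[OF B])
        (auto intro: square_integrable_borel continuous_intros)
    have "s * t \<le> s\<^sup>2 + t\<^sup>2" for s t :: real
      using zero_le_power2[of "s - t"] zero_le_power2[of s] zero_le_power2[of t]
      unfolding power2_diff by linarith
    then have "norm (f x) * norm (g x) * K \<le> ((norm (f x))\<^sup>2 + (norm (g x))\<^sup>2) * K" for x
      using B_le(1) by (intro mult_right_mono) auto
    then show "AE x in M. norm (B (f x) (g x)) \<le> norm (K * ((norm (f x))\<^sup>2 + (norm (g x))\<^sup>2))"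
      using B_le(1) by (intro AE_I2 order_trans[OF B_le(2)]) (simp add: abs_mult mult.commute)
  qed
qed

lemma integral_quadratic_lincomb:
  fixes B :: "'a::euclidean_space \<Rightarrow> 'a \<Rightarrow> real"
  assumes B: "bounded_bilinear B" "\<And>u v. B u v = B v u"
    and f: "square_integrable M f" and g: "square_integrable M g"
  shows "(LINT x|M. B (\<alpha> *\<^sub>R f x + \<beta> *\<^sub>R g x) (\<alpha> *\<^sub>R f x + \<beta> *\<^sub>R g x))
    = \<alpha>\<^sup>2 * (LINT x|M. B (f x) (f x)) + 2 * (\<alpha> * \<beta>) * (LINT x|M. B (f x) (g x))
      + \<beta>\<^sup>2 * (LINT x|M. B (g x) (g x))"
proof -
  interpret bounded_bilinear B
    by (rule B)
  have "B (\<alpha> *\<^sub>R u + \<beta> *\<^sub>R v) (\<alpha> *\<^sub>R u + \<beta> *\<^sub>R v)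
      = \<alpha>\<^sup>2 * B u u + 2 * (\<alpha> * \<beta>) * B u v + \<beta>\<^sup>2 * B v v" for u v
    using B(2)[of v u] by (simp add: add_left add_right scaleR_left scaleR_right power2_eq_square algebra_simps)
  then show ?thesis
    using integrable_bounded_bilinear[OF B(1) f f] integrable_bounded_bilinear[OF B(1) f g]
      integrable_bounded_bilinear[OF B(1) g g] by simp
qed

lemma integrable_norm_mult_norm:
  assumes "square_integrable M f" "square_integrable M g"
  shows "integrable M (\<lambda>x. norm (f x) * norm (g x))"
  using assms by (intro integrable_bounded_bilinear[OF bounded_bilinear_mult])
    (auto simp: square_integrable_def)

lemma Cauchy_Schwarz_integral:
  assumes f: "square_integrable M f" and g: "square_integrable M g"
  shows "(LINT x|M. norm (f x) * norm (g x))
    \<le> sqrt (LINT x|M. (norm (f x))\<^sup>2) * sqrt (LINT x|M. (norm (g x))\<^sup>2)"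
proof -
  note [measurable] = square_integrable_borel[OF f] square_integrable_borel[OF g]
  have "(\<integral>\<^sup>+x. ennreal (norm (f x)) * ennreal (norm (g x)) \<partial>M)\<^sup>2
      \<le> (\<integral>\<^sup>+x. (ennreal (norm (f x)))\<^sup>2 \<partial>M) * (\<integral>\<^sup>+x. (ennreal (norm (g x)))\<^sup>2 \<partial>M)"
    by (intro Cauchy_Schwarz_nn_integral) measurable
  then have "(LINT x|M. norm (f x) * norm (g x))\<^sup>2
      \<le> (LINT x|M. (norm (f x))\<^sup>2) * (LINT x|M. (norm (g x))\<^sup>2)"
    using integrable_norm_mult_norm[OF f g] f g
    by (simp add: ennreal_power nn_integral_eq_integral square_integrable_norm_sq flip: ennreal_mult)
  then show ?thesis
    unfolding real_sqrt_mult[symmetric] by (rule real_le_rsqrt)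
qed

lemma integral_abs_inner_le:
  assumes f: "square_integrable M f" and g: "square_integrable M g"
  shows "(LINT x|M. \<bar>f x \<bullet> g x\<bar>) \<le> sqrt (LINT x|M. (norm (f x))\<^sup>2) * sqrt (LINT x|M. (norm (g x))\<^sup>2)"
proof -
  have "(LINT x|M. \<bar>f x \<bullet> g x\<bar>) \<le> (LINT x|M. norm (f x) * norm (g x))"
    using integrable_bounded_bilinear[OF bounded_bilinear_inner f g] integrable_norm_mult_norm[OF f g]
    by (intro integral_mono integrable_abs Cauchy_Schwarz_ineq2)
  also note Cauchy_Schwarz_integral[OF f g]
  finally show ?thesis .
qed

section \<open>Test functions\<close>

lemma test_fun_iff:
  "test_fun \<phi> \<longleftrightarrow> (\<forall>x. (\<phi> has_real_derivative deriv \<phi> x) (at x)) \<and> continuous_on UNIV (deriv \<phi>)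
     \<and> bounded {x. \<phi> x \<noteq> 0}"
proof -
  have "deriv \<phi> = D" if "\<And>x. (\<phi> has_vector_derivative D x) (at x)" for D
    using that by (auto intro!: DERIV_imp_deriv simp: has_real_derivative_iff_has_vector_derivative)
  then show ?thesis
    unfolding test_fun_def C1_differentiable_on_def has_real_derivative_iff_has_vector_derivative
    by auto
qed

lemma test_funI:
  assumes "\<And>x. (\<phi> has_real_derivative \<phi>' x) (at x)" "continuous_on UNIV \<phi>'"
    and "\<And>x. \<bar>x\<bar> > R \<Longrightarrow> \<phi> x = 0"
  shows "test_fun \<phi>" "deriv \<phi> = \<phi>'"
proof -
  show deriv_eq: "deriv \<phi> = \<phi>'"
    using assms(1) DERIV_imp_deriv by blast
  have "bounded {x. \<phi> x \<noteq> 0}"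
    using assms(3) by (intro boundedI[of _ R]) (force simp: not_less)
  with assms(1,2) show "test_fun \<phi>"
    by (simp add: test_fun_iff deriv_eq)
qed

lemma test_fun_continuous:
  assumes "test_fun \<phi>"
  shows "continuous_on UNIV \<phi>" "continuous_on UNIV (deriv \<phi>)"
  using assms unfolding test_fun_iff
  by (meson DERIV_isCont continuous_at_imp_continuous_on)+

lemma test_fun_support:
  assumes "test_fun \<phi>"
  obtains R where "\<And>x. \<bar>x\<bar> > R \<Longrightarrow> \<phi> x = 0" "\<And>x. \<bar>x\<bar> > R \<Longrightarrow> deriv \<phi> x = 0"
proof -
  obtain R where support_le: "\<And>x. \<phi> x \<noteq> 0 \<Longrightarrow> \<bar>x\<bar> \<le> R"
    using assms unfolding test_fun_def bounded_iff by auto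
  have vanish: "\<phi> x = 0" if "\<bar>x\<bar> > R" for x
    using support_le[of x] that by force
  have "deriv \<phi> x = 0" if "\<bar>x\<bar> > R" for x
  proof (rule DERIV_imp_deriv)
    have "open {x::real. \<bar>x\<bar> > R}"
      by (intro open_Collect_less continuous_intros)
    then show "(\<phi> has_field_derivative 0) (at x)"
      by (rule has_field_derivative_transform_within_open[OF DERIV_const[of 0]])
        (use that vanish in auto)
  qed
  with vanish show thesis
    by (rule that)
qed

lemma test_fun_mult_C1:
  assumes \<eta>: "test_fun \<eta>"
    and \<Gamma>: "\<And>x. (\<Gamma> has_real_derivative \<gamma> x) (at x)" "continuous_on UNIV \<gamma>"
  shows "test_fun (\<lambda>x. \<eta> x * \<Gamma> x)" "deriv (\<lambda>x. \<eta> x * \<Gamma> x) = (\<lambda>x. deriv \<eta> x * \<Gamma> x + \<eta> x * \<gamma> x)"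
proof -
  obtain R where support: "\<And>x. \<bar>x\<bar> > R \<Longrightarrow> \<eta> x = 0"
    using test_fun_support[OF \<eta>] by metis
  have deriv: "((\<lambda>x. \<eta> x * \<Gamma> x) has_real_derivative deriv \<eta> x * \<Gamma> x + \<eta> x * \<gamma> x) (at x)" for x
    using \<eta> \<Gamma>(1) unfolding test_fun_iff by (auto intro!: derivative_eq_intros)
  have "continuous_on UNIV \<Gamma>"
    using \<Gamma>(1) DERIV_isCont continuous_at_imp_continuous_on by blast
  then have cont: "continuous_on UNIV (\<lambda>x. deriv \<eta> x * \<Gamma> x + \<eta> x * \<gamma> x)"
    using \<Gamma>(2) test_fun_continuous[OF \<eta>] by (intro continuous_intros)
  show "test_fun (\<lambda>x. \<eta> x * \<Gamma> x)" "deriv (\<lambda>x. \<eta> x * \<Gamma> x) = (\<lambda>x. deriv \<eta> x * \<Gamma> x + \<eta> x * \<gamma> x)"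
    using test_funI[OF deriv cont, of R] support by simp_all
qed

definition bump :: "real \<Rightarrow> real \<Rightarrow> real" where
  "bump a x = (max 0 (1 - (x - a)\<^sup>2))\<^sup>2"

lemma bump_nonneg: "0 \<le> bump a x"
  by (simp add: bump_def)

lemma bump_eq_0: "\<bar>x - a\<bar> \<ge> 1 \<Longrightarrow> bump a x = 0"
  by (simp add: bump_def abs_le_square_iff[of 1, simplified])

lemma bump_ge_on_unit_interval:
  assumes "\<bar>x - a\<bar> \<le> 1 / 2"
  shows "9 / 16 \<le> bump a x"
proof -
  have "(x - a)\<^sup>2 \<le> (1 / 2)\<^sup>2"
    using assms abs_le_square_iff[of "x - a" "1 / 2"] by simp
  then have "3 / 4 \<le> max 0 (1 - (x - a)\<^sup>2)"
    unfolding power_divide by auto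
  then have "(3 / 4)\<^sup>2 \<le> bump a x"
    unfolding bump_def by (rule power_mono) simp
  then show ?thesis
    by (simp add: power2_eq_square)
qed

lemma has_real_derivative_max_0_sq: "((\<lambda>y. (max 0 y)\<^sup>2) has_real_derivative 2 * max 0 y) (at y)"
proof (cases y "0::real" rule: linorder_cases)
  case less
  have "((\<lambda>y. 0) has_real_derivative 2 * max 0 y) (at y)"
    using less by simp
  then show ?thesis
    by (rule has_field_derivative_transform_within_open[of _ _ _ "{..<0}"]) (use less in auto)
next
  case equal
  have "(\<lambda>h::real. (max 0 h)\<^sup>2 / h) \<midarrow>0\<rightarrow> 0"
    by (rule Lim_null_comparison[where g=abs], rule always_eventually)
      (auto simp: power2_eq_square max_def intro!: tendsto_eq_intros)
  then show ?thesis
    by (simp add: DERIV_def equal)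
next
  case greater
  have "((\<lambda>y. y\<^sup>2) has_real_derivative 2 * max 0 y) (at y)"
    using greater by (auto intro!: derivative_eq_intros)
  then show ?thesis
    by (rule has_field_derivative_transform_within_open[of _ _ _ "{0<..}"]) (use greater in auto)
qed

lemma test_fun_bump: "test_fun (bump a)"
  and deriv_bump: "deriv (bump a) = (\<lambda>x. - 4 * (x - a) * max 0 (1 - (x - a)\<^sup>2))"
proof -
  have deriv: "(bump a has_real_derivative - 4 * (x - a) * max 0 (1 - (x - a)\<^sup>2)) (at x)" for x
  proof -
    have "((\<lambda>x. 1 - (x - a)\<^sup>2) has_real_derivative - 2 * (x - a)) (at x)"
      by (auto intro!: derivative_eq_intros)
    from DERIV_chain2[OF has_real_derivative_max_0_sq this] show ?thesis
      unfolding bump_def[abs_def] by (simp add: algebra_simps)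
  qed
  have cont: "continuous_on UNIV (\<lambda>x. - 4 * (x - a) * max 0 (1 - (x - a)\<^sup>2))"
    by (intro continuous_intros)
  have support: "bump a x = 0" if "\<bar>x\<bar> > \<bar>a\<bar> + 1" for x
    using that by (intro bump_eq_0) auto
  show "test_fun (bump a)" "deriv (bump a) = (\<lambda>x. - 4 * (x - a) * max 0 (1 - (x - a)\<^sup>2))"
    using test_funI[OF deriv cont support] by simp_all
qed

lemma deriv_bump_sq_add_bump_sq_le: "(deriv (bump a) x)\<^sup>2 + (bump a x)\<^sup>2 \<le> 17 * indicator {a - 1..a + 1} x"
proof -
  define m where "m = max 0 (1 - (x - a)\<^sup>2)"
  have "deriv (bump a) x = - 4 * (x - a) * m" "bump a x = m\<^sup>2"
    by (simp_all only: deriv_bump bump_def m_def)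
  then have sum_eq: "(deriv (bump a) x)\<^sup>2 + (bump a x)\<^sup>2 = 16 * ((x - a)\<^sup>2 * m\<^sup>2) + (m\<^sup>2)\<^sup>2"
    by algebra
  show ?thesis
  proof (cases "\<bar>x - a\<bar> \<le> 1")
    case True
    have m: "0 \<le> m" "m \<le> 1"
      by (auto simp: m_def)
    then have "(x - a)\<^sup>2 * m\<^sup>2 \<le> 1 * 1\<^sup>2"
      using True by (intro mult_mono power_mono) (auto simp: abs_square_le_1)
    moreover have "(m\<^sup>2)\<^sup>2 \<le> 1"
      using m by (intro power_le_one) auto
    ultimately show ?thesis
      using True unfolding sum_eq by (auto simp: abs_le_iff)
  next
    case False
    then have "m = 0"
      using abs_square_le_1[of "x - a"] by (simp add: m_def)
    then show ?thesis
      unfolding sum_eq by simp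
  qed
qed

lemma AE_if_AE_bump_ge:
  assumes "\<And>n::int. AE x in lborel. 9 / 16 \<le> bump (of_int n) x \<longrightarrow> P x"
  shows "AE x in lborel. P x"
proof -
  have "AE x in lborel. \<forall>n::int. 9 / 16 \<le> bump (of_int n) x \<longrightarrow> P x"
    using assms by (subst AE_all_countable) blast
  then show ?thesis
  proof eventually_elim
    case (elim x)
    have "\<bar>x - of_int (round x)\<bar> \<le> 1 / 2"
      using of_int_round_abs_le[of x] by (simp add: abs_minus_commute)
    with elim show ?case
      using bump_ge_on_unit_interval by blast
  qed
qed

section \<open>Locally integrable functions\<close>

lemma loc_integrable_borel:
  assumes "loc_integrable f"
  shows "f \<in> borel_measurable lborel"
proof (rule borel_measurable_LIMSEQ_metric)
  show "(\<lambda>x. indicator {-real n..real n} x *\<^sub>R f x) \<in> borel_measurable lborel" for n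
    using assms unfolding loc_integrable_def set_integrable_def
    by (intro borel_measurable_integrable) blast
  show "(\<lambda>n. indicator {-real n..real n} x *\<^sub>R f x) \<longlonglongrightarrow> f x" for x
  proof (rule tendsto_eventually)
    obtain N where "\<bar>x\<bar> \<le> real N"
      using real_arch_simple by blast
    then show "\<forall>\<^sub>F n in sequentially. indicator {-real n..real n} x *\<^sub>R f x = f x"
      by (intro eventually_sequentiallyI[of N]) (auto simp: indicator_def abs_le_iff)
  qed
qed

lemma loc_integrable_continuous: "continuous_on UNIV f \<Longrightarrow> loc_integrable f"
  unfolding loc_integrable_def
  by (auto intro!: borel_integrable_atLeastAtMost' elim: continuous_on_subset)

lemma loc_integrable_lincomb:
  assumes "loc_integrable f" "loc_integrable g"
  shows "loc_integrable (\<lambda>x. \<alpha> * f x + \<beta> * g x)"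
  using assms unfolding loc_integrable_def
  by (intro allI set_integral_add(1) set_integrable_mult_right impI) blast+

lemma loc_integrable_cong_AE:
  assumes "loc_integrable f" "g \<in> borel_measurable lborel" "AE x in lborel. f x = g x"
  shows "loc_integrable g"
  unfolding loc_integrable_def set_integrable_def
proof (intro allI)
  fix r s :: real
  show "integrable lborel (\<lambda>x. indicator {r..s} x *\<^sub>R g x)"
  proof (rule integrable_cong_AE_imp)
    show "integrable lborel (\<lambda>x. indicator {r..s} x *\<^sub>R f x)"
      using assms(1) unfolding loc_integrable_def set_integrable_def by blast
    show "AE x in lborel. indicator {r..s} x *\<^sub>R f x = indicator {r..s} x *\<^sub>R g x"
      using assms(3) by eventually_elim simp
  qed (use assms(2) in simp)
qed

lemma loc_integrable_mult_continuous:
  assumes f: "loc_integrable f" and g: "continuous_on UNIV g"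
  shows "loc_integrable (\<lambda>x. f x * g x)"
  unfolding loc_integrable_def set_integrable_def
proof (intro allI)
  fix r s
  have [measurable]: "f \<in> borel_measurable borel" "g \<in> borel_measurable borel"
    using loc_integrable_borel[OF f] borel_measurable_continuous_onI[OF g] by simp_all
  have "bounded (g ` {r..s})"
    by (intro compact_imp_bounded compact_continuous_image continuous_on_subset[OF g]) auto
  then obtain B where g_le: "\<And>x. x \<in> {r..s} \<Longrightarrow> \<bar>g x\<bar> \<le> B"
    unfolding bounded_iff by force
  show "integrable lborel (\<lambda>x. indicator {r..s} x *\<^sub>R (f x * g x))"
  proof (rule Bochner_Integration.integrable_bound)
    show "integrable lborel (\<lambda>x. B * (indicator {r..s} x *\<^sub>R f x))"
      using f unfolding loc_integrable_def set_integrable_def by (intro integrable_mult_right) blast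
    show "AE x in lborel. norm (indicator {r..s} x *\<^sub>R (f x * g x)) \<le> norm (B * (indicator {r..s} x *\<^sub>R f x))"
      using mult_left_mono[OF order_trans[OF g_le abs_ge_self], of _ "\<bar>f _\<bar>"]
      by (intro AE_I2) (auto simp: indicator_def abs_mult mult.commute)
  qed measurable
qed

lemma integrable_loc_integrable_mult:
  assumes f: "loc_integrable f" and g: "continuous_on UNIV g" "\<And>x. \<bar>x\<bar> > R \<Longrightarrow> g x = 0"
  shows "integrable lborel (\<lambda>x. f x * g x)"
proof -
  have "integrable lborel (\<lambda>x. indicator {-R..R} x *\<^sub>R (f x * g x))"
    using loc_integrable_mult_continuous[OF f g(1)] unfolding loc_integrable_def set_integrable_def by blast
  also have "(\<lambda>x. indicator {-R..R} x *\<^sub>R (f x * g x)) = (\<lambda>x. f x * g x)"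
    using g(2) by (force simp: indicator_def)
  finally show ?thesis .
qed

lemma integrable_loc_integrable_test:
  assumes "loc_integrable f" "test_fun \<phi>"
  shows "integrable lborel (\<lambda>x. f x * \<phi> x)" "integrable lborel (\<lambda>x. f x * deriv \<phi> x)"
  using test_fun_support[OF assms(2)] test_fun_continuous[OF assms(2)] assms(1)
    integrable_loc_integrable_mult by metis+

section \<open>The fundamental lemma of the calculus of variations\<close>

lemma continuous_polynomial_approximation:
  fixes h :: "nat \<Rightarrow> 'a::euclidean_space \<Rightarrow> real"
  assumes "compact S" "\<And>n. continuous_on S (h n)"
  obtains p where "\<And>n. real_polynomial_function (p n)"
    "\<And>n x. x \<in> S \<Longrightarrow> \<bar>h n x - p n x\<bar> < inverse (real (Suc n))"
proof -
  have "\<exists>p. real_polynomial_function p \<and> (\<forall>x\<in>S. \<bar>h n x - p x\<bar> < inverse (real (Suc n)))" for n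
    using Stone_Weierstrass_real_polynomial_function[OF assms, of "inverse (real (Suc n))" n]
    by (metis inverse_positive_iff_positive of_nat_0_less_iff zero_less_Suc)
  then show thesis
    using that by metis
qed

lemma bounded_measurable_AE_limit_polynomials:
  fixes f :: "'a::euclidean_space \<Rightarrow> real"
  assumes f: "f \<in> borel_measurable borel" "\<And>x. \<bar>f x\<bar> \<le> B" and S: "compact S"
  obtains p where "\<And>n. real_polynomial_function (p n)" "\<And>n x. x \<in> S \<Longrightarrow> \<bar>p n x\<bar> \<le> B + 1"
    "AE x in lborel. x \<in> S \<longrightarrow> (\<lambda>n. p n x) \<longlonglongrightarrow> f x"
proof -
  have "f measurable_on UNIV"
    using f(1) by (intro lebesgue_measurable_imp_measurable_on measurable_completion) auto
  then obtain N g where N: "negligible N" and g: "\<And>n. continuous_on UNIV (g n)"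
    and g_lim: "\<And>x. x \<notin> N \<Longrightarrow> (\<lambda>n::nat. g n x) \<longlonglongrightarrow> f x"
    unfolding measurable_on_def by auto
  define h where "h n x = max (- B) (min B (g n x))" for n x
  have "continuous_on S (h n)" for n
    unfolding h_def[abs_def] by (intro continuous_intros continuous_on_subset[OF g]) auto
  then obtain p where p: "\<And>n. real_polynomial_function (p n)"
    and close: "\<And>n x. x \<in> S \<Longrightarrow> \<bar>h n x - p n x\<bar> < inverse (real (Suc n))"
    using continuous_polynomial_approximation[OF S, of h] by blast
  show thesis
  proof (rule that[OF p])
    have h_le: "\<bar>h n x\<bar> \<le> B" for n x
      using f(2)[of x] by (auto simp: h_def)
    have inverse_le: "inverse (real (Suc n)) \<le> 1" for n
      by (simp add: field_simps)
    show "\<bar>p n x\<bar> \<le> B + 1" if "x \<in> S" for n x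
      using close[OF that, of n] h_le[of n x] inverse_le[of n] by linarith
    have "AE x in lborel. x \<notin> N"
      using AE_not_in[of N lebesgue] N unfolding negligible_iff_null_sets AE_completion_iff .
    then show "AE x in lborel. x \<in> S \<longrightarrow> (\<lambda>n. p n x) \<longlonglongrightarrow> f x"
    proof (eventually_elim, intro impI)
      fix x assume "x \<notin> N" "x \<in> S"
      have "(\<lambda>n. h n x) \<longlonglongrightarrow> max (- B) (min B (f x))"
        unfolding h_def by (intro tendsto_intros g_lim \<open>x \<notin> N\<close>)
      moreover have "(\<lambda>n. h n x - p n x) \<longlonglongrightarrow> 0"
        using close[OF \<open>x \<in> S\<close>]
        by (intro Lim_null_comparison[OF _ LIMSEQ_inverse_real_of_nat] always_eventually)
          (auto intro: less_imp_le)
      ultimately have "(\<lambda>n. h n x - (h n x - p n x)) \<longlonglongrightarrow> max (- B) (min B (f x)) - 0"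
        by (rule tendsto_diff)
      then show "(\<lambda>n. p n x) \<longlonglongrightarrow> f x"
        using f(2)[of x] by (simp add: abs_le_iff)
    qed
  qed
qed

lemma test_fun_AE_limit_indicator:
  assumes \<eta>: "test_fun \<eta>" "\<And>x. 0 \<le> \<eta> x" and A: "A \<in> sets borel"
  obtains \<phi> where "\<And>n. test_fun (\<phi> n)" "\<And>n x. 0 \<le> \<phi> n x" "\<And>n x. \<phi> n x \<le> 4 * \<eta> x"
    "AE x in lborel. (\<lambda>n. \<phi> n x) \<longlonglongrightarrow> indicator A x * \<eta> x"
proof -
  obtain R where support: "\<And>x. \<bar>x\<bar> > R \<Longrightarrow> \<eta> x = 0"
    using test_fun_support[OF \<eta>(1)] by metis
  obtain p where p: "\<And>n. real_polynomial_function (p n)" "\<And>n x. x \<in> {-R..R} \<Longrightarrow> \<bar>p n x\<bar> \<le> 1 + 1"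
    and p_lim: "AE x in lborel. x \<in> {-R..R} \<longrightarrow> (\<lambda>n. p n x) \<longlonglongrightarrow> indicator A x"
    by (rule bounded_measurable_AE_limit_polynomials[of "indicator A" 1 "{-R..R}"])
      (use A in \<open>auto simp: indicator_def\<close>)
  show thesis
  proof (rule that)
    show "test_fun (\<lambda>x. \<eta> x * (p n x)\<^sup>2)" for n
    proof -
      obtain p' where p': "real_polynomial_function p'" "\<And>x. (p n has_real_derivative p' x) (at x)"
        using has_real_derivative_polynomial_function[OF p(1)] by blast
      show ?thesis
      proof (rule test_fun_mult_C1[OF \<eta>(1)])
        show "((\<lambda>x. (p n x)\<^sup>2) has_real_derivative 2 * p n x * p' x) (at x)" for x
          using p'(2) by (auto intro!: derivative_eq_intros)
        show "continuous_on UNIV (\<lambda>x. 2 * p n x * p' x)"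
          using p(1) p'(1) by (intro continuous_intros continuous_on_polymonial_function)
            (auto simp: real_polynomial_function_eq)
      qed
    qed
    show "0 \<le> \<eta> x * (p n x)\<^sup>2" "\<eta> x * (p n x)\<^sup>2 \<le> 4 * \<eta> x" for n x
      using \<eta>(2)[of x] support[of x] power_mono[of "\<bar>p n x\<bar>" 2 2] p(2)[of x n]
      by (cases "x \<in> {-R..R}"; force simp: mult.commute[of 4] intro: mult_left_mono)+
    show "AE x in lborel. (\<lambda>n. \<eta> x * (p n x)\<^sup>2) \<longlonglongrightarrow> indicator A x * \<eta> x"
      using p_lim
    proof eventually_elim
      case (elim x)
      show ?case
      proof (cases "\<bar>x\<bar> \<le> R")
        case True
        with elim have "(\<lambda>n. \<eta> x * (p n x)\<^sup>2) \<longlonglongrightarrow> \<eta> x * (indicator A x)\<^sup>2"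
          by (intro tendsto_intros) (auto simp: abs_le_iff)
        then show ?thesis
          by (cases "x \<in> A") simp_all
      qed (simp add: support)
    qed
  qed
qed

lemma AE_nonneg_if_test_nonneg:
  assumes f: "loc_integrable f"
    and nonneg: "\<And>\<phi>. test_fun \<phi> \<Longrightarrow> (\<And>x. 0 \<le> \<phi> x) \<Longrightarrow> 0 \<le> (LINT x|lborel. f x * \<phi> x)"
  shows "AE x in lborel. 0 \<le> f x"
proof (rule AE_if_AE_bump_ge)
  fix n :: int
  let ?\<eta> = "bump (of_int n)"
  note f\<eta> = integrable_loc_integrable_test(1)[OF f test_fun_bump[of "of_int n"]]
  have [measurable]: "(\<lambda>x. f x * ?\<eta> x) \<in> borel_measurable borel"
    using borel_measurable_integrable[OF f\<eta>] by simp
  have "AE x in lborel. 0 \<le> f x * ?\<eta> x"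
  proof (rule sigma_finite_measure.density_nonneg[OF sigma_finite_lborel f\<eta>])
    fix A :: "real set" assume "A \<in> sets lborel"
    then have [measurable]: "A \<in> sets borel"
      by simp
    obtain \<phi> where \<phi>: "\<And>m. test_fun (\<phi> m)" "\<And>m x. 0 \<le> \<phi> m x" "\<And>m x. \<phi> m x \<le> 4 * ?\<eta> x"
      and \<phi>_lim: "AE x in lborel. (\<lambda>m. \<phi> m x) \<longlonglongrightarrow> indicator A x * ?\<eta> x"
      using test_fun_AE_limit_indicator[OF test_fun_bump bump_nonneg \<open>A \<in> sets borel\<close>] by blast
    have "(\<lambda>m. LINT x|lborel. f x * \<phi> m x) \<longlonglongrightarrow> (LINT x|lborel. indicator A x *\<^sub>R (f x * ?\<eta> x))"
    proof (rule integral_dominated_convergence[where w="\<lambda>x. 4 * norm (f x * ?\<eta> x)"])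
      show "AE x in lborel. (\<lambda>m. f x * \<phi> m x) \<longlonglongrightarrow> indicator A x *\<^sub>R (f x * ?\<eta> x)"
        using \<phi>_lim
      proof eventually_elim
        case (elim x)
        then show ?case
          using tendsto_mult[OF tendsto_const[of "f x"]] by (simp add: mult.left_commute)
      qed
      show "AE x in lborel. norm (f x * \<phi> m x) \<le> 4 * norm (f x * ?\<eta> x)" for m
        using mult_left_mono[OF \<phi>(3), of "\<bar>f _\<bar>" m] \<phi>(2) bump_nonneg
        by (intro AE_I2) (simp add: abs_mult mult_ac)
      show "(\<lambda>x. f x * \<phi> m x) \<in> borel_measurable lborel" for m
        using borel_measurable_integrable[OF integrable_loc_integrable_test(1)[OF f \<phi>(1)]] .
    qed (use f\<eta> in auto)
    then show "0 \<le> set_lebesgue_integral lborel A (\<lambda>x. f x * ?\<eta> x)"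
      unfolding set_lebesgue_integral_def by (rule LIMSEQ_le_const) (use nonneg \<phi> in auto)
  qed
  then show "AE x in lborel. 9 / 16 \<le> ?\<eta> x \<longrightarrow> 0 \<le> f x"
    by eventually_elim (auto simp: zero_le_mult_iff)
qed

lemma AE_eq_0_if_test_eq_0:
  assumes f: "loc_integrable f"
    and zero: "\<And>\<phi>. test_fun \<phi> \<Longrightarrow> (LINT x|lborel. f x * \<phi> x) = 0"
  shows "AE x in lborel. f x = 0"
proof -
  have "loc_integrable (\<lambda>x. - f x)"
    using loc_integrable_lincomb[OF f f, of "-1" 0] by simp
  then have "AE x in lborel. 0 \<le> - f x"
    by (rule AE_nonneg_if_test_nonneg) (simp add: zero)
  moreover have "AE x in lborel. 0 \<le> f x"
    using f by (rule AE_nonneg_if_test_nonneg) (simp add: zero)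
  ultimately show ?thesis
    by eventually_elim auto
qed

section \<open>Weak derivatives\<close>

lemma weak_deriv_unique:
  assumes u1: "weak_deriv u u1" and u2: "weak_deriv u u2"
  shows "AE x in lborel. u1 x = u2 x"
proof -
  have loc: "loc_integrable u1" "loc_integrable u2"
    using u1 u2 by (auto simp: weak_deriv_def)
  have "AE x in lborel. 1 * u1 x + (-1) * u2 x = 0"
  proof (rule AE_eq_0_if_test_eq_0[OF loc_integrable_lincomb[OF loc]])
    fix \<phi> assume \<phi>: "test_fun \<phi>"
    have "(LINT x|lborel. u1 x * \<phi> x) = (LINT x|lborel. u2 x * \<phi> x)"
      using u1 u2 \<phi> unfolding weak_deriv_def by fastforce
    then show "(LINT x|lborel. (1 * u1 x + (-1) * u2 x) * \<phi> x) = 0"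
      using integrable_loc_integrable_test(1)[OF _ \<phi>] loc by (simp add: left_diff_distrib)
  qed
  then show ?thesis
    by simp
qed

lemma weak_deriv_cong_AE:
  assumes u1: "weak_deriv u u1" and u_eq_w: "AE x in lborel. u x = w x" and w: "w \<in> borel_measurable lborel"
  shows "weak_deriv w u1"
proof -
  have loc: "loc_integrable u" "loc_integrable w"
    using assms loc_integrable_cong_AE by (auto simp: weak_deriv_def)
  have "(LINT x|lborel. u x * deriv \<phi> x) = (LINT x|lborel. w x * deriv \<phi> x)" if "test_fun \<phi>" for \<phi>
    using u_eq_w integrable_loc_integrable_test(2)[OF loc(1) that]
      integrable_loc_integrable_test(2)[OF loc(2) that]
    by (intro integral_cong_AE) auto
  then show ?thesis
    using u1 loc(2) unfolding weak_deriv_def by auto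
qed

lemma weak_deriv_lincomb:
  assumes u: "weak_deriv u u1" and v: "weak_deriv v v1"
  shows "weak_deriv (\<lambda>x. \<alpha> * u x + \<beta> * v x) (\<lambda>x. \<alpha> * u1 x + \<beta> * v1 x)"
proof -
  have loc: "loc_integrable u" "loc_integrable u1" "loc_integrable v" "loc_integrable v1"
    using assms by (auto simp: weak_deriv_def)
  have "(LINT x|lborel. (\<alpha> * u x + \<beta> * v x) * deriv \<phi> x)
      = - (LINT x|lborel. (\<alpha> * u1 x + \<beta> * v1 x) * \<phi> x)" if \<phi>: "test_fun \<phi>" for \<phi>
    using integrable_loc_integrable_test[OF _ \<phi>] loc u v \<phi> unfolding weak_deriv_def
    by (simp add: distrib_right mult.assoc)
  then show ?thesis
    using loc loc_integrable_lincomb unfolding weak_deriv_def by blast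
qed

lemma wd_AE_eq:
  assumes "weak_deriv u u1"
  shows "weak_deriv u (wd u)" "AE x in lborel. wd u x = u1 x"
proof -
  show "weak_deriv u (wd u)"
    unfolding wd_def using assms by (rule someI[of "weak_deriv u"])
  then show "AE x in lborel. wd u x = u1 x"
    using assms weak_deriv_unique by blast
qed

lemma wd_borel: "weak_deriv u u1 \<Longrightarrow> wd u \<in> borel_measurable lborel"
  using wd_AE_eq(1) loc_integrable_borel unfolding weak_deriv_def by blast

lemma wd_wd_AE_eq:
  assumes "weak_deriv u u1" "weak_deriv u1 u2"
  shows "weak_deriv (wd u) (wd (wd u))" "AE x in lborel. wd (wd u) x = u2 x"
proof -
  have "AE x in lborel. u1 x = wd u x"
    using wd_AE_eq(2)[OF assms(1)] by eventually_elim simp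
  then have "weak_deriv (wd u) u2"
    using weak_deriv_cong_AE[OF assms(2)] wd_borel[OF assms(1)] by blast
  then show "weak_deriv (wd u) (wd (wd u))" "AE x in lborel. wd (wd u) x = u2 x"
    by (rule wd_AE_eq)+
qed

section \<open>The Sobolev embedding on the line\<close>

lemma nonneg_continuous_antiderivative:
  fixes g :: "real \<Rightarrow> real"
  assumes cont: "continuous_on UNIV g" and nonneg: "\<And>x. 0 \<le> g x" and integrable_g: "integrable lborel g"
  obtains \<Gamma> where "\<And>x. (\<Gamma> has_real_derivative g x) (at x)"
    "\<And>x. 0 \<le> \<Gamma> x" "\<And>x. \<Gamma> x \<le> (LINT x|lborel. g x)"
proof -
  have "\<exists>F. \<forall>x::real. -\<infinity> < ereal x \<longrightarrow> ereal x < \<infinity> \<longrightarrow> (F has_vector_derivative g x) (at x)"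
    using cont by (intro einterval_antiderivative) (auto simp: continuous_on_eq_continuous_at)
  then obtain \<Phi> where \<Phi>: "\<And>x. (\<Phi> has_vector_derivative g x) (at x)"
    by auto
  have increment: "\<Phi> y - \<Phi> x \<le> (LINT x|lborel. g x)" "0 \<le> \<Phi> y - \<Phi> x" if "x \<le> y" for x y
  proof -
    have "(LINT z|lborel. indicator {x..y} z *\<^sub>R g z) = \<Phi> y - \<Phi> x"
      using that \<Phi> cont by (intro integral_FTC_atLeastAtMost)
        (auto intro: has_vector_derivative_at_within continuous_on_subset)
    moreover have "(LINT z|lborel. indicator {x..y} z *\<^sub>R g z) \<le> (LINT z|lborel. g z)"
      using nonneg integrable_g by (intro integral_mono integrable_mult_indicator) (auto simp: indicator_def)
    moreover have "0 \<le> (LINT z|lborel. indicator {x..y} z *\<^sub>R g z)"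
      using nonneg by (intro integral_nonneg_AE AE_I2) auto
    ultimately show "\<Phi> y - \<Phi> x \<le> (LINT x|lborel. g x)" "0 \<le> \<Phi> y - \<Phi> x"
      by simp_all
  qed
  have "0 \<le> (LINT x|lborel. g x)"
    using nonneg by (intro integral_nonneg_AE AE_I2)
  then have minus_integral_le: "\<Phi> x - (LINT x|lborel. g x) \<le> \<Phi> y" for x y
    using increment[of x y] increment[of y x] by linarith
  define m where "m = Inf (range \<Phi>)"
  have bdd_below_range: "bdd_below (range \<Phi>)"
    using minus_integral_le[of 0] by (intro bdd_belowI2)
  show thesis
  proof (rule that)
    show "((\<lambda>x. \<Phi> x - m) has_real_derivative g x) (at x)" for x
      using \<Phi> by (auto intro!: derivative_eq_intros simp: has_real_derivative_iff_has_vector_derivative)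
    show "0 \<le> \<Phi> x - m" for x
      using cInf_lower[OF _ bdd_below_range] by (simp add: m_def)
    have "\<Phi> x - (LINT x|lborel. g x) \<le> m" for x
      unfolding m_def using minus_integral_le by (intro cInf_greatest) auto
    then show "\<Phi> x - m \<le> (LINT x|lborel. g x)" for x
      by (simp add: algebra_simps)
  qed
qed

lemma weak_deriv_test_product:
  assumes u: "weak_deriv u u1" and \<eta>: "test_fun \<eta>"
    and \<Gamma>: "\<And>x. (\<Gamma> has_real_derivative \<gamma> x) (at x)" "continuous_on UNIV \<gamma>"
  shows "(LINT x|lborel. u x * \<eta> x * \<gamma> x) = - (LINT x|lborel. (u1 x * \<eta> x + u x * deriv \<eta> x) * \<Gamma> x)"
    and "integrable lborel (\<lambda>x. (u1 x * \<eta> x + u x * deriv \<eta> x) * \<Gamma> x)"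
proof -
  have loc: "loc_integrable u" "loc_integrable u1"
    using u by (auto simp: weak_deriv_def)
  obtain R where support: "\<And>x. \<bar>x\<bar> > R \<Longrightarrow> \<eta> x = 0" "\<And>x. \<bar>x\<bar> > R \<Longrightarrow> deriv \<eta> x = 0"
    using test_fun_support[OF \<eta>] by metis
  have \<Gamma>_cont: "continuous_on UNIV \<Gamma>"
    using \<Gamma>(1) DERIV_isCont continuous_at_imp_continuous_on by blast
  note \<phi> = test_fun_mult_C1[OF \<eta> \<Gamma>]
  have integrable_products: "integrable lborel (\<lambda>x. u x * (\<eta> x * \<gamma> x))"
    "integrable lborel (\<lambda>x. u x * (deriv \<eta> x * \<Gamma> x))"
    "integrable lborel (\<lambda>x. u1 x * (\<eta> x * \<Gamma> x))"
    by (intro integrable_loc_integrable_mult[where R=R] loc continuous_intros \<Gamma>(2) \<Gamma>_cont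
        test_fun_continuous[OF \<eta>]; use support in simp)+
  have "(LINT x|lborel. u x * (\<eta> x * \<gamma> x)) + (LINT x|lborel. u x * (deriv \<eta> x * \<Gamma> x))
      = (LINT x|lborel. u x * deriv (\<lambda>x. \<eta> x * \<Gamma> x) x)"
    using integrable_products by (simp add: \<phi>(2) distrib_left add.commute)
  also have "\<dots> = - (LINT x|lborel. u1 x * (\<eta> x * \<Gamma> x))"
    using u \<phi>(1) unfolding weak_deriv_def by blast
  finally show "(LINT x|lborel. u x * \<eta> x * \<gamma> x)
      = - (LINT x|lborel. (u1 x * \<eta> x + u x * deriv \<eta> x) * \<Gamma> x)"
    using integrable_products by (simp add: distrib_right mult.assoc)
  show "integrable lborel (\<lambda>x. (u1 x * \<eta> x + u x * deriv \<eta> x) * \<Gamma> x)"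
    using integrable_products by (simp add: distrib_right mult.assoc)
qed

text \<open>The test function is the product of \<open>\<eta>\<close> with an antiderivative of \<open>g\<close>, which lies between
  \<open>0\<close> and the integral of \<open>g\<close>.\<close>

lemma abs_integral_mult_test_le:
  assumes u: "weak_deriv u u1" and \<eta>: "test_fun \<eta>"
    and g: "continuous_on UNIV g" "\<And>x. 0 \<le> g x" "integrable lborel g"
  shows "\<bar>LINT x|lborel. u x * \<eta> x * g x\<bar>
    \<le> (LINT x|lborel. \<bar>u1 x * \<eta> x + u x * deriv \<eta> x\<bar>) * (LINT x|lborel. g x)"
proof -
  obtain \<Gamma> where \<Gamma>: "\<And>x. (\<Gamma> has_real_derivative g x) (at x)"
    and \<Gamma>_bounds: "\<And>x. 0 \<le> \<Gamma> x" "\<And>x. \<Gamma> x \<le> (LINT x|lborel. g x)"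
    using nonneg_continuous_antiderivative[OF g] by blast
  have integrable_product: "integrable lborel (\<lambda>x. u1 x * \<eta> x + u x * deriv \<eta> x)"
    using weak_deriv_test_product(2)[OF u \<eta>, of "\<lambda>_. 1" "\<lambda>_. 0"] by simp
  have "\<bar>LINT x|lborel. u x * \<eta> x * g x\<bar> \<le> (LINT x|lborel. \<bar>(u1 x * \<eta> x + u x * deriv \<eta> x) * \<Gamma> x\<bar>)"
    unfolding weak_deriv_test_product(1)[OF u \<eta> \<Gamma> g(1)] by simp
  also have "\<dots> \<le> (LINT x|lborel. \<bar>u1 x * \<eta> x + u x * deriv \<eta> x\<bar> * (LINT x|lborel. g x))"
    using integrable_product \<Gamma>_bounds
    by (intro integral_mono integrable_abs weak_deriv_test_product(2)[OF u \<eta> \<Gamma> g(1)])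
      (auto simp: abs_mult intro!: mult_left_mono)
  finally show ?thesis
    by simp
qed

lemma AE_abs_mult_test_le:
  assumes u: "weak_deriv u u1" and \<eta>: "test_fun \<eta>"
  shows "AE x in lborel. \<bar>u x * \<eta> x\<bar> \<le> (LINT x|lborel. \<bar>u1 x * \<eta> x + u x * deriv \<eta> x\<bar>)"
proof -
  define m where "m = (LINT x|lborel. \<bar>u1 x * \<eta> x + u x * deriv \<eta> x\<bar>)"
  have loc: "loc_integrable (\<lambda>x. u x * \<eta> x)" "loc_integrable (\<lambda>_. 1)"
    using u loc_integrable_mult_continuous[OF _ test_fun_continuous(1)[OF \<eta>], of u]
    by (auto simp: weak_deriv_def intro: loc_integrable_continuous)
  have "AE x in lborel. 0 \<le> m * 1 + s * (u x * \<eta> x)" if s: "s \<in> {-1, 1}" for s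
  proof (rule AE_nonneg_if_test_nonneg[OF loc_integrable_lincomb[OF loc(2,1)]])
    fix g assume g: "test_fun g" "\<And>x. 0 \<le> g x"
    note g_int = integrable_loc_integrable_test(1)[OF loc(2) g(1)]
    have "(LINT x|lborel. (m * 1 + s * (u x * \<eta> x)) * g x)
        = m * (LINT x|lborel. g x) + s * (LINT x|lborel. u x * \<eta> x * g x)"
      using integrable_loc_integrable_test(1)[OF loc(1) g(1)] g_int by (simp add: distrib_right mult.assoc)
    moreover have "\<bar>LINT x|lborel. u x * \<eta> x * g x\<bar> \<le> m * (LINT x|lborel. g x)"
      unfolding m_def using g g_int test_fun_continuous(1)[OF g(1)]
      by (intro abs_integral_mult_test_le[OF u \<eta>]) simp_all
    ultimately show "0 \<le> (LINT x|lborel. (m * 1 + s * (u x * \<eta> x)) * g x)"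
      using s by auto
  qed
  from this[of 1] this[of "-1"] show ?thesis
    unfolding m_def[symmetric] by (auto elim: eventually_elim2)
qed

lemma H1_mult_test_AE_le:
  assumes u: "weak_deriv u u1" "sq_int u" "sq_int u1" and \<eta>: "test_fun \<eta>"
  shows "AE x in lborel. \<bar>u x * \<eta> x\<bar>
    \<le> sqrt (LINT x|lborel. (u x)\<^sup>2 + (u1 x)\<^sup>2) * sqrt (LINT x|lborel. (deriv \<eta> x)\<^sup>2 + (\<eta> x)\<^sup>2)"
proof -
  have loc: "loc_integrable \<eta>" "loc_integrable (deriv \<eta>)"
    using test_fun_continuous[OF \<eta>] loc_integrable_continuous by auto
  have "sq_int \<eta>" "sq_int (deriv \<eta>)"
    using integrable_loc_integrable_test(1)[OF loc(1) \<eta>] integrable_loc_integrable_test(2)[OF loc(2) \<eta>]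
      loc loc_integrable_borel by (auto simp: sq_int_def power2_eq_square)
  then have pairs: "square_integrable lborel (\<lambda>x. (u x, u1 x))"
    "square_integrable lborel (\<lambda>x. (deriv \<eta> x, \<eta> x))"
    using u unfolding sq_int_iff_square_integrable by (simp_all add: square_integrable_Pair)
  have "u1 x * \<eta> x + u x * deriv \<eta> x = (u x, u1 x) \<bullet> (deriv \<eta> x, \<eta> x)" for x
    by simp
  then have "(LINT x|lborel. \<bar>u1 x * \<eta> x + u x * deriv \<eta> x\<bar>)
      = (LINT x|lborel. \<bar>(u x, u1 x) \<bullet> (deriv \<eta> x, \<eta> x)\<bar>)"
    by presburger
  also have "\<dots> \<le> sqrt (LINT x|lborel. (norm (u x, u1 x))\<^sup>2) * sqrt (LINT x|lborel. (norm (deriv \<eta> x, \<eta> x))\<^sup>2)"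
    using pairs by (rule integral_abs_inner_le)
  finally have "(LINT x|lborel. \<bar>u1 x * \<eta> x + u x * deriv \<eta> x\<bar>)
      \<le> sqrt (LINT x|lborel. (u x)\<^sup>2 + (u1 x)\<^sup>2) * sqrt (LINT x|lborel. (deriv \<eta> x)\<^sup>2 + (\<eta> x)\<^sup>2)"
    by (simp add: norm_Pair)
  then show ?thesis
    using AE_abs_mult_test_le[OF u(1) \<eta>] by (auto elim: eventually_mono)
qed

lemma H1_embedding:
  assumes u: "weak_deriv u u1" "sq_int u" "sq_int u1"
  shows "AE x in lborel. \<bar>u x\<bar> \<le> 11 * sqrt (LINT x|lborel. (u x)\<^sup>2 + (u1 x)\<^sup>2)"
proof (rule AE_if_AE_bump_ge)
  fix n :: int
  let ?\<eta> = "bump (of_int n)" and ?N = "sqrt (LINT x|lborel. (u x)\<^sup>2 + (u1 x)\<^sup>2)"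
  have N: "0 \<le> ?N"
    by (intro real_sqrt_ge_zero integral_nonneg_AE) auto
  have "(LINT x|lborel. (deriv ?\<eta> x)\<^sup>2 + (?\<eta> x)\<^sup>2)
      \<le> (LINT x|lborel. 17 * indicator {of_int n - 1..of_int n + 1::real} x)"
    by (intro integral_mono' deriv_bump_sq_add_bump_sq_le) auto
  then have "sqrt (LINT x|lborel. (deriv ?\<eta> x)\<^sup>2 + (?\<eta> x)\<^sup>2) \<le> 6"
    by (intro real_sqrt_le_iff'[THEN iffD2]) auto
  from mult_left_mono[OF this N]
  have "?N * sqrt (LINT x|lborel. (deriv ?\<eta> x)\<^sup>2 + (?\<eta> x)\<^sup>2) \<le> 6 * ?N"
    by (simp only: mult.commute)
  then have "AE x in lborel. \<bar>u x * ?\<eta> x\<bar> \<le> 6 * ?N"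
    using H1_mult_test_AE_le[OF u test_fun_bump, of "of_int n"] by (auto elim!: eventually_mono)
  then show "AE x in lborel. 9 / 16 \<le> ?\<eta> x \<longrightarrow> \<bar>u x\<bar> \<le> 11 * ?N"
  proof (eventually_elim, intro impI)
    fix x assume mult_le: "\<bar>u x * ?\<eta> x\<bar> \<le> 6 * ?N" and \<eta>: "9 / 16 \<le> ?\<eta> x"
    have "\<bar>u x\<bar> * (9 / 16) \<le> \<bar>u x\<bar> * ?\<eta> x"
      using \<eta> by (intro mult_left_mono) auto
    with mult_le \<eta> N show "\<bar>u x\<bar> \<le> 11 * ?N"
      by (simp add: abs_mult)
  qed
qed

section \<open>Integral functionals with quadratically bounded densities\<close>

definition bounded_square_integrable :: "'m measure \<Rightarrow> ('m \<Rightarrow> 'a::euclidean_space) \<Rightarrow> bool" where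
  "bounded_square_integrable M W \<longleftrightarrow> square_integrable M W \<and> (\<exists>R. AE x in M. norm (W x) \<le> R)"

lemma bounded_square_integrableD:
  assumes "bounded_square_integrable M W"
  shows "square_integrable M W"
    and bounded_square_integrable_borel [measurable_dest]: "W \<in> borel_measurable M"
  using assms unfolding bounded_square_integrable_def by (auto dest: square_integrable_borel)

lemma bounded_square_integrable_bound:
  assumes "bounded_square_integrable M W"
  obtains R where "0 \<le> R" "AE x in M. norm (W x) \<le> R"
proof -
  obtain R where "AE x in M. norm (W x) \<le> R"
    using assms unfolding bounded_square_integrable_def by blast
  then have "AE x in M. norm (W x) \<le> \<bar>R\<bar>"
    by eventually_elim linarith
  then show thesis
    using that[of "\<bar>R\<bar>"] by simp
qed

lemma norm_lincomb_le:
  fixes u v :: "'a::real_normed_vector"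
  assumes "norm u \<le> R" "norm v \<le> S"
  shows "norm (\<alpha> *\<^sub>R u + \<beta> *\<^sub>R v) \<le> \<bar>\<alpha>\<bar> * R + \<bar>\<beta>\<bar> * S"
  using assms by (intro norm_triangle_le add_mono) (auto intro: mult_left_mono)

lemma bounded_square_integrable_lincomb:
  assumes W: "bounded_square_integrable M W" and V: "bounded_square_integrable M V"
  shows "bounded_square_integrable M (\<lambda>x. \<alpha> *\<^sub>R W x + \<beta> *\<^sub>R V x)"
proof -
  obtain R S where "AE x in M. norm (W x) \<le> R" "AE x in M. norm (V x) \<le> S"
    using W V unfolding bounded_square_integrable_def by blast
  then have "AE x in M. norm (\<alpha> *\<^sub>R W x + \<beta> *\<^sub>R V x) \<le> \<bar>\<alpha>\<bar> * R + \<bar>\<beta>\<bar> * S"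
    by eventually_elim (rule norm_lincomb_le)
  then show ?thesis
    using W V square_integrable_lincomb unfolding bounded_square_integrable_def by blast
qed

lemma bounded_square_integrable_scaleR:
  "bounded_square_integrable M W \<Longrightarrow> bounded_square_integrable M (\<lambda>x. t *\<^sub>R W x)"
  using bounded_square_integrable_lincomb[of M W W t 0] by simp

lemma bounded_square_integrable_Pair_0:
  assumes "bounded_square_integrable M W"
  shows "bounded_square_integrable M (\<lambda>x. (W x, 0))" "bounded_square_integrable M (\<lambda>x. (0, W x))"
  using assms by (auto simp: bounded_square_integrable_def square_integrable_def norm_Pair
      intro: borel_measurable_Pair)

definition quadratically_bounded :: "('a::euclidean_space \<Rightarrow> real) \<Rightarrow> bool" where
  "quadratically_bounded f \<longleftrightarrow> continuous_on UNIV f \<and>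
     (\<forall>R\<ge>0. \<exists>C\<ge>0. \<forall>w. norm w \<le> R \<longrightarrow> \<bar>f w\<bar> \<le> C * (norm w)\<^sup>2)"

lemma quadratically_bounded_dominated:
  assumes f: "quadratically_bounded f"
    and W: "bounded_square_integrable M W" and V: "bounded_square_integrable M V"
  obtains w where "integrable M w"
    "\<And>\<alpha> \<beta>. \<bar>\<alpha>\<bar> \<le> A \<Longrightarrow> \<bar>\<beta>\<bar> \<le> A \<Longrightarrow> AE x in M. norm (f (\<alpha> *\<^sub>R W x + \<beta> *\<^sub>R V x)) \<le> w x"
proof -
  obtain R where W_le: "0 \<le> R" "AE x in M. norm (W x) \<le> R"
    using bounded_square_integrable_bound[OF W] .
  obtain S where V_le: "0 \<le> S" "AE x in M. norm (V x) \<le> S"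
    using bounded_square_integrable_bound[OF V] .
  obtain C where f_le: "0 \<le> C" "\<And>w. norm w \<le> \<bar>A\<bar> * R + \<bar>A\<bar> * S \<Longrightarrow> \<bar>f w\<bar> \<le> C * (norm w)\<^sup>2"
    using f W_le(1) V_le(1) unfolding quadratically_bounded_def
    by (metis abs_ge_zero add_nonneg_nonneg mult_nonneg_nonneg)
  show thesis
  proof (rule that)
    show "integrable M (\<lambda>x. C * (2 * A\<^sup>2 * (norm (W x))\<^sup>2 + 2 * A\<^sup>2 * (norm (V x))\<^sup>2))"
      using W V by (simp add: bounded_square_integrableD square_integrable_norm_sq)
    fix \<alpha> \<beta> assume \<alpha>\<beta>: "\<bar>\<alpha>\<bar> \<le> A" "\<bar>\<beta>\<bar> \<le> A"
    show "AE x in M. norm (f (\<alpha> *\<^sub>R W x + \<beta> *\<^sub>R V x))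
        \<le> C * (2 * A\<^sup>2 * (norm (W x))\<^sup>2 + 2 * A\<^sup>2 * (norm (V x))\<^sup>2)"
      using W_le(2) V_le(2)
    proof eventually_elim
      case (elim x)
      have "\<bar>\<alpha>\<bar> * R + \<bar>\<beta>\<bar> * S \<le> \<bar>A\<bar> * R + \<bar>A\<bar> * S"
        using \<alpha>\<beta> W_le(1) V_le(1) by (intro add_mono mult_right_mono) auto
      then have "\<bar>f (\<alpha> *\<^sub>R W x + \<beta> *\<^sub>R V x)\<bar> \<le> C * (norm (\<alpha> *\<^sub>R W x + \<beta> *\<^sub>R V x))\<^sup>2"
        using norm_lincomb_le[OF elim] by (intro f_le(2)) (rule order_trans)
      also have "\<dots> \<le> C * (2 * (\<alpha>\<^sup>2 * (norm (W x))\<^sup>2) + 2 * (\<beta>\<^sup>2 * (norm (V x))\<^sup>2))"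
        using norm_add_sq_le[of "\<alpha> *\<^sub>R W x" "\<beta> *\<^sub>R V x"] f_le(1)
        by (intro mult_left_mono) (auto simp: power_mult_distrib)
      also have "\<dots> \<le> C * (2 * A\<^sup>2 * (norm (W x))\<^sup>2 + 2 * A\<^sup>2 * (norm (V x))\<^sup>2)"
        using \<alpha>\<beta> f_le(1) unfolding mult.assoc
        by (intro mult_left_mono add_mono mult_right_mono) (auto simp: abs_le_square_iff[symmetric])
      finally show ?case
        by simp
    qed
  qed
qed

lemma integrable_quadratically_bounded:
  assumes f: "quadratically_bounded f" and W: "bounded_square_integrable M W"
  shows "integrable M (\<lambda>x. f (W x))"
proof -
  obtain w where w: "integrable M w"
    "\<And>\<alpha> \<beta>. \<bar>\<alpha>\<bar> \<le> 1 \<Longrightarrow> \<bar>\<beta>\<bar> \<le> 1 \<Longrightarrow> AE x in M. norm (f (\<alpha> *\<^sub>R W x + \<beta> *\<^sub>R W x)) \<le> w x"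
    using quadratically_bounded_dominated[OF f W W, of 1] by blast
  have [measurable]: "f \<in> borel_measurable borel" "W \<in> borel_measurable M"
    using f W borel_measurable_continuous_onI bounded_square_integrable_borel
    unfolding quadratically_bounded_def by blast+
  have "AE x in M. norm (f (W x)) \<le> norm (w x)"
    using w(2)[of 1 0] by (auto elim: eventually_mono)
  then show ?thesis
    by (intro Bochner_Integration.integrable_bound[OF w(1)]) measurable
qed

lemma continuous_on_integral_quadratically_bounded:
  assumes f: "quadratically_bounded f"
    and W: "bounded_square_integrable M W" and V: "bounded_square_integrable M V"
  shows "continuous_on UNIV (\<lambda>(\<alpha>, \<beta>). LINT x|M. f (\<alpha> *\<^sub>R W x + \<beta> *\<^sub>R V x))"
proof (rule continuous_on_sequentiallyI)
  fix c :: "nat \<Rightarrow> real \<times> real" and c0 assume lim: "c \<longlonglongrightarrow> c0"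
  have f_cont: "continuous_on UNIV f"
    using f unfolding quadratically_bounded_def by blast
  then have [measurable]: "f \<in> borel_measurable borel"
    by (rule borel_measurable_continuous_onI)
  note [measurable] = bounded_square_integrable_borel[OF W] bounded_square_integrable_borel[OF V]
  obtain A where "\<And>n. norm (c n) \<le> A"
    using convergent_imp_Bseq[OF convergentI[OF lim]] unfolding Bseq_def by blast
  then have A: "\<bar>fst (c n)\<bar> \<le> A" "\<bar>snd (c n)\<bar> \<le> A" for n
    using norm_fst_le[of "fst (c n)" "snd (c n)"] norm_snd_le[of "snd (c n)" "fst (c n)"]
    by (auto intro: order_trans)
  obtain w where w: "integrable M w"
    "\<And>\<alpha> \<beta>. \<bar>\<alpha>\<bar> \<le> A \<Longrightarrow> \<bar>\<beta>\<bar> \<le> A \<Longrightarrow> AE x in M. norm (f (\<alpha> *\<^sub>R W x + \<beta> *\<^sub>R V x)) \<le> w x"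
    using quadratically_bounded_dominated[OF f W V, of A] by blast
  have "(\<lambda>n. LINT x|M. f (fst (c n) *\<^sub>R W x + snd (c n) *\<^sub>R V x))
      \<longlonglongrightarrow> (LINT x|M. f (fst c0 *\<^sub>R W x + snd c0 *\<^sub>R V x))"
  proof (rule integral_dominated_convergence[OF _ _ w(1) _ w(2)[OF A]])
    show "AE x in M. (\<lambda>n. f (fst (c n) *\<^sub>R W x + snd (c n) *\<^sub>R V x))
        \<longlonglongrightarrow> f (fst c0 *\<^sub>R W x + snd c0 *\<^sub>R V x)"
      by (intro AE_I2 continuous_on_tendsto_compose[OF f_cont] tendsto_intros lim) auto
  qed measurable
  then show "(\<lambda>n. case c n of (\<alpha>, \<beta>) \<Rightarrow> LINT x|M. f (\<alpha> *\<^sub>R W x + \<beta> *\<^sub>R V x))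
      \<longlonglongrightarrow> (case c0 of (\<alpha>, \<beta>) \<Rightarrow> LINT x|M. f (\<alpha> *\<^sub>R W x + \<beta> *\<^sub>R V x))"
    by (simp add: case_prod_unfold)
qed

lemma tendsto_integral_quadratically_bounded:
  assumes f: "quadratically_bounded f"
    and W: "bounded_square_integrable M W" and V: "bounded_square_integrable M V"
    and lim: "(\<alpha> \<longlongrightarrow> a) \<F>" "(\<beta> \<longlongrightarrow> b) \<F>"
  shows "((\<lambda>n. LINT x|M. f (\<alpha> n *\<^sub>R W x + \<beta> n *\<^sub>R V x)) \<longlongrightarrow> (LINT x|M. f (a *\<^sub>R W x + b *\<^sub>R V x))) \<F>"
  using continuous_on_tendsto_compose[OF continuous_on_integral_quadratically_bounded[OF f W V]
      tendsto_Pair[OF lim]] by simp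

section \<open>Superquadratic potentials\<close>

lemma has_real_derivative_ray:
  fixes g :: "'a::real_inner \<Rightarrow> real"
  assumes "\<And>w. (g has_derivative (\<lambda>h. Dg w \<bullet> h)) (at w)"
  shows "((\<lambda>s. g (s *\<^sub>R w)) has_real_derivative Dg (s *\<^sub>R w) \<bullet> w) (at s)"
  unfolding has_field_derivative_def
  by (rule has_derivative_eq_rhs[OF has_derivative_compose[OF _ assms]])
    (auto intro!: derivative_eq_intros simp: fun_eq_iff)

lemma powr_scaling_if_Euler_inequality:
  fixes g :: "'a::real_inner \<Rightarrow> real"
  assumes deriv: "\<And>w. (g has_derivative (\<lambda>h. Dg w \<bullet> h)) (at w)"
    and Euler: "\<And>w. r * g w \<le> w \<bullet> Dg w" and t: "1 \<le> t"
  shows "t powr r * g w \<le> g (t *\<^sub>R w)"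
proof -
  define f where "f s = g (s *\<^sub>R w) * s powr - r" for s
  have "f 1 \<le> f t"
  proof (rule DERIV_nonneg_imp_nondecreasing[OF t])
    fix s :: real assume "1 \<le> s"
    then have s: "0 < s"
      by simp
    have "((\<lambda>s. g (s *\<^sub>R w)) has_real_derivative Dg (s *\<^sub>R w) \<bullet> w) (at s)"
      using deriv by (rule has_real_derivative_ray)
    moreover have "((\<lambda>s. s powr - r) has_real_derivative - r * s powr (- r - 1)) (at s)"
      using s by (auto intro!: derivative_eq_intros)
    ultimately have "(f has_real_derivative
        Dg (s *\<^sub>R w) \<bullet> w * s powr - r + - r * s powr (- r - 1) * g (s *\<^sub>R w)) (at s)"
      unfolding f_def[abs_def] by (rule DERIV_mult)
    moreover have "Dg (s *\<^sub>R w) \<bullet> w * s powr - r + - r * s powr (- r - 1) * g (s *\<^sub>R w)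
        = s powr (- r - 1) * ((s *\<^sub>R w) \<bullet> Dg (s *\<^sub>R w) - r * g (s *\<^sub>R w))"
      using powr_mult_base[of s "- r - 1"] s by (simp add: inner_commute algebra_simps)
    moreover have "0 \<le> s powr (- r - 1) * ((s *\<^sub>R w) \<bullet> Dg (s *\<^sub>R w) - r * g (s *\<^sub>R w))"
      using Euler by (intro mult_nonneg_nonneg) (simp_all only: powr_ge_zero diff_ge_0_iff_ge)
    ultimately show "\<exists>y. (f has_real_derivative y) (at s) \<and> 0 \<le> y"
      by auto
  qed
  then show ?thesis
    using t by (simp add: f_def powr_minus field_simps)
qed

lemma powr_minus_one_div_mono:
  fixes t :: real
  assumes t: "0 < t" and exponents: "0 < a" "a \<le> b"
  shows "(t powr a - 1) / a \<le> (t powr b - 1) / b"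
proof -
  have "b / a * (t powr a - 1) \<le> (t powr a) powr (b / a) - 1 powr (b / a)"
  proof (rule convex_on_imp_above_tangent[where A="{0<..}" and f="\<lambda>x. x powr (b / a)"])
    show "convex_on {0<..} (\<lambda>x. x powr (b / a))"
      using exponents by (intro powr_convex) (simp add: field_simps)
    show "((\<lambda>x. x powr (b / a)) has_field_derivative b / a) (at 1 within {0<..})"
      by (auto intro!: derivative_eq_intros)
  qed (use t in \<open>auto simp: interior_open\<close>)
  then show ?thesis
    using exponents by (simp add: powr_powr field_simps)
qed

locale superquadratic =
  fixes F :: "'a::euclidean_space \<Rightarrow> real" and DF :: "'a \<Rightarrow> 'a" and p :: real
  assumes F_0: "F 0 = 0"
    and F_deriv: "(F has_derivative (\<lambda>h. DF w \<bullet> h)) (at w)"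
    and DF_Lipschitz: "\<exists>C. C-lipschitz_on (cball 0 R) DF"
    and p_pos: "0 < p"
    and scaling: "1 \<le> t \<Longrightarrow> t powr (p + 2) * (w \<bullet> DF w) \<le> (t *\<^sub>R w) \<bullet> DF (t *\<^sub>R w)"
begin

definition G :: "'a \<Rightarrow> real" where "G w = w \<bullet> DF w"

lemma G_scale_ge: "1 \<le> t \<Longrightarrow> t powr (p + 2) * G w \<le> G (t *\<^sub>R w)"
  using scaling by (simp add: G_def)

lemma G_scale_le:
  assumes "0 < t" "t \<le> 1"
  shows "G (t *\<^sub>R w) \<le> t powr (p + 2) * G w"
proof -
  have "(1 / t) powr (p + 2) * G (t *\<^sub>R w) \<le> G w"
    using G_scale_ge[of "1 / t" "t *\<^sub>R w"] assms by simp
  then show ?thesis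
    using assms by (simp add: powr_divide field_simps)
qed

lemma F_continuous: "continuous_on UNIV F"
  by (intro continuous_at_imp_continuous_on ballI has_derivative_continuous[OF F_deriv])

lemma DF_continuous: "continuous_on UNIV DF"
proof (intro continuous_at_imp_continuous_on ballI)
  fix w :: 'a
  obtain C where "C-lipschitz_on (cball 0 (norm w + 1)) DF"
    using DF_Lipschitz by blast
  then have "continuous_on (ball 0 (norm w + 1)) DF"
    using lipschitz_on_continuous_on continuous_on_subset ball_subset_cball by blast
  then show "isCont DF w"
    by (auto simp: continuous_on_eq_continuous_at)
qed

text \<open>Superquadratic growth along rays excludes a linear part at the origin.\<close>

lemma DF_0: "DF 0 = 0"
proof -
  let ?g = "DF 0"
  have "?g \<bullet> DF (t *\<^sub>R ?g) \<le> t powr (p + 1) * G ?g" if "0 < t" "t < 1" for t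
  proof -
    have "t * (?g \<bullet> DF (t *\<^sub>R ?g)) \<le> t * (t powr (p + 1) * G ?g)"
      using G_scale_le[of t ?g] that powr_add[of t 1 "p + 1"] by (simp add: G_def add_ac)
    then show ?thesis
      using that by simp
  qed
  then have "\<forall>\<^sub>F t in at_right 0. ?g \<bullet> DF (t *\<^sub>R ?g) \<le> t powr (p + 1) * G ?g"
    unfolding eventually_at_right_field by (intro exI[of _ 1]) simp
  moreover have "((\<lambda>t. ?g \<bullet> DF (t *\<^sub>R ?g)) \<longlongrightarrow> ?g \<bullet> DF (0 *\<^sub>R ?g)) (at_right 0)"
    by (intro tendsto_intros continuous_on_tendsto_compose[OF DF_continuous]) auto
  moreover have "((\<lambda>t. t powr (p + 1) * G ?g) \<longlongrightarrow> 0 powr (p + 1) * G ?g) (at_right 0)"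
    using p_pos eventually_at_right_less[of "0::real"]
    by (intro tendsto_intros tendsto_powr') (auto elim: eventually_mono)
  ultimately have "?g \<bullet> DF (0 *\<^sub>R ?g) \<le> 0 powr (p + 1) * G ?g"
    by (intro tendsto_le) auto
  then show ?thesis
    by (simp add: order_antisym_conv)
qed

lemma has_real_derivative_F_ray_minus_powr:
  assumes s: "0 < s"
  shows "((\<lambda>s. F (s *\<^sub>R w) - G w * s powr (p + 2) / (p + 2))
    has_real_derivative (G (s *\<^sub>R w) - s powr (p + 2) * G w) / s) (at s)"
proof -
  have "((\<lambda>s. F (s *\<^sub>R w)) has_real_derivative DF (s *\<^sub>R w) \<bullet> w) (at s)"
    using F_deriv by (rule has_real_derivative_ray)
  moreover have "((\<lambda>s. G w * s powr (p + 2) / (p + 2)) has_real_derivative G w * s powr (p + 1)) (at s)"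
    using s p_pos by (auto intro!: derivative_eq_intros simp: add.commute)
  moreover have "s powr (p + 2) = s powr (p + 1) * s"
    using s powr_add[of s "p + 1" 1] by (simp add: add.assoc)
  then have "DF (s *\<^sub>R w) \<bullet> w - G w * s powr (p + 1) = (G (s *\<^sub>R w) - s powr (p + 2) * G w) / s"
    using s by (simp add: G_def field_simps inner_commute)
  ultimately show ?thesis
    by (auto intro: DERIV_cong[OF DERIV_diff])
qed

lemma F_scale_ge:
  assumes t: "0 < t"
  shows "G w * (t powr (p + 2) - 1) / (p + 2) \<le> F (t *\<^sub>R w) - F w"
proof -
  define f where "f s = F (s *\<^sub>R w) - G w * s powr (p + 2) / (p + 2)" for s
  have deriv: "(f has_real_derivative (G (s *\<^sub>R w) - s powr (p + 2) * G w) / s) (at s)" if "0 < s" for s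
    using has_real_derivative_F_ray_minus_powr[OF that] by (simp add: f_def[abs_def])
  have "f 1 \<le> f t"
  proof (cases "1 \<le> t")
    case True
    show ?thesis
    proof (rule DERIV_nonneg_imp_nondecreasing[OF True])
      fix s :: real assume s: "1 \<le> s"
      then have "0 \<le> (G (s *\<^sub>R w) - s powr (p + 2) * G w) / s"
        using G_scale_ge[of s w] by (intro divide_nonneg_nonneg) auto
      then show "\<exists>y. (f has_real_derivative y) (at s) \<and> 0 \<le> y"
        using deriv[of s] s by auto
    qed
  next
    case False
    then have "t \<le> 1"
      by simp
    then show ?thesis
    proof (rule DERIV_nonpos_imp_nonincreasing)
      fix s assume s: "t \<le> s" "s \<le> 1"
      with t have "(G (s *\<^sub>R w) - s powr (p + 2) * G w) / s \<le> 0"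
        using G_scale_le[of s w] by (intro divide_nonpos_nonneg) auto
      then show "\<exists>y. (f has_real_derivative y) (at s) \<and> y \<le> 0"
        using deriv[of s] s t by auto
    qed
  qed
  then show ?thesis
    by (simp add: f_def right_diff_distrib diff_divide_distrib)
qed

lemma F_le_G: "F w \<le> G w / (p + 2)"
proof -
  have F_lim: "((\<lambda>t. F (t *\<^sub>R w) - F w) \<longlongrightarrow> F (0 *\<^sub>R w) - F w) (at_right 0)"
    by (intro tendsto_intros continuous_on_tendsto_compose[OF F_continuous]) auto
  have powr_lim: "((\<lambda>t. G w * (t powr (p + 2) - 1) / (p + 2))
      \<longlongrightarrow> G w * (0 powr (p + 2) - 1) / (p + 2)) (at_right 0)"
    using p_pos eventually_at_right_less[of "0::real"]
    by (intro tendsto_intros tendsto_powr') (auto elim: eventually_mono)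
  have "\<forall>\<^sub>F t in at_right 0. G w * (t powr (p + 2) - 1) / (p + 2) \<le> F (t *\<^sub>R w) - F w"
    unfolding eventually_at_right_field using F_scale_ge by (intro exI[of _ 1]) simp
  from tendsto_le[OF trivial_limit_at_right_real F_lim powr_lim this] show ?thesis
    using p_pos by (simp add: F_0)
qed

lemma F_linearisation:
  "\<exists>C\<ge>0. \<forall>w h. norm w \<le> R \<longrightarrow> norm h \<le> R \<longrightarrow> \<bar>F (w + h) - F w - DF w \<bullet> h\<bar> \<le> C * (norm h)\<^sup>2"
proof -
  obtain C where lipschitz: "C-lipschitz_on (cball 0 (2 * R)) DF"
    using DF_Lipschitz by blast
  have "\<bar>F (w + h) - F w - DF w \<bullet> h\<bar> \<le> C * (norm h)\<^sup>2" if bounds: "norm w \<le> R" "norm h \<le> R" for w h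
  proof -
    let ?f = "\<lambda>x. F x - DF w \<bullet> x"
    have "norm (?f (w + h) - ?f w) \<le> C * norm h * norm (w + h - w)"
    proof (rule differentiable_bound)
      fix x assume "x \<in> closed_segment w (w + h)"
      then have x: "norm (x - w) \<le> norm h"
        using segment_bound1[of x w "w + h"] by simp
      show "(?f has_derivative (\<lambda>k. (DF x - DF w) \<bullet> k)) (at x within closed_segment w (w + h))"
        by (rule has_derivative_at_withinI)
          (auto intro!: derivative_eq_intros F_deriv simp: inner_diff_left)
      have "x \<in> cball 0 (2 * R)" "w \<in> cball 0 (2 * R)"
        using norm_triangle_ineq[of "x - w" w] x bounds norm_ge_zero[of w] by (simp_all del: norm_ge_zero)
      then have "norm (DF x - DF w) \<le> C * norm (x - w)"
        using lipschitz_on_normD[OF lipschitz] by blast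
      also have "\<dots> \<le> C * norm h"
        using x lipschitz_on_nonneg[OF lipschitz] by (rule mult_left_mono)
      finally show "onorm (\<lambda>k. (DF x - DF w) \<bullet> k) \<le> C * norm h"
        by (intro onorm_le) (auto intro!: order_trans[OF Cauchy_Schwarz_ineq2] mult_right_mono)
    qed (auto intro: convex_closed_segment)
    then show ?thesis
      by (simp add: inner_right_distrib power2_eq_square algebra_simps)
  qed
  then show ?thesis
    using lipschitz_on_nonneg[OF lipschitz] by blast
qed

lemma quadratically_bounded_F: "quadratically_bounded F"
  unfolding quadratically_bounded_def
proof (intro conjI allI impI F_continuous)
  fix R :: real assume R: "0 \<le> R"
  obtain C where "0 \<le> C"
    and linearisation: "\<And>w h. norm w \<le> R \<Longrightarrow> norm h \<le> R \<Longrightarrow> \<bar>F (w + h) - F w - DF w \<bullet> h\<bar> \<le> C * (norm h)\<^sup>2"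
    using F_linearisation by blast
  moreover have "\<bar>F w\<bar> \<le> C * (norm w)\<^sup>2" if "norm w \<le> R" for w
    using linearisation[of 0 w] that R by (simp add: F_0 DF_0)
  ultimately show "\<exists>C\<ge>0. \<forall>w. norm w \<le> R \<longrightarrow> \<bar>F w\<bar> \<le> C * (norm w)\<^sup>2"
    by blast
qed

lemma quadratically_bounded_DF_inner: "quadratically_bounded (\<lambda>(w, v). DF w \<bullet> v)"
  unfolding quadratically_bounded_def case_prod_unfold
proof (intro conjI allI impI)
  show "continuous_on UNIV (\<lambda>z. DF (fst z) \<bullet> snd z)"
    by (intro continuous_intros continuous_on_compose2[OF DF_continuous]) auto
  fix R :: real assume R: "0 \<le> R"
  obtain C where lipschitz: "C-lipschitz_on (cball 0 R) DF"
    using DF_Lipschitz by blast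
  have "\<bar>DF (fst z) \<bullet> snd z\<bar> \<le> C * (norm z)\<^sup>2" if "norm z \<le> R" for z
  proof -
    have component_le: "norm (fst z) \<le> norm z" "norm (snd z) \<le> norm z"
      using norm_fst_le[of "fst z" "snd z"] norm_snd_le[of "snd z" "fst z"] by simp_all
    then have "norm (DF (fst z) - DF 0) \<le> C * norm (fst z - 0)"
      using that R by (intro lipschitz_on_normD[OF lipschitz]) auto
    then have "norm (DF (fst z)) \<le> C * norm z"
      using component_le mult_left_mono[OF component_le(1) lipschitz_on_nonneg[OF lipschitz]] by (simp add: DF_0)
    then have "norm (DF (fst z)) * norm (snd z) \<le> C * norm z * norm z"
      using component_le lipschitz_on_nonneg[OF lipschitz] by (intro mult_mono) auto
    then show ?thesis
      using Cauchy_Schwarz_ineq2[of "DF (fst z)" "snd z"] by (simp add: power2_eq_square mult.assoc)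
  qed
  then show "\<exists>C\<ge>0. \<forall>z. norm z \<le> R \<longrightarrow> \<bar>DF (fst z) \<bullet> snd z\<bar> \<le> C * (norm z)\<^sup>2"
    using lipschitz_on_nonneg[OF lipschitz] by blast
qed

lemma quadratically_bounded_G: "quadratically_bounded G"
  unfolding quadratically_bounded_def
proof (intro conjI allI impI)
  show "continuous_on UNIV G"
    unfolding G_def[abs_def] by (intro continuous_intros DF_continuous)
  fix R :: real assume "0 \<le> R"
  then have "0 \<le> 2 * R"
    by simp
  then obtain C where DF_inner_le: "0 \<le> C"
    "\<And>z. norm z \<le> 2 * R \<Longrightarrow> \<bar>(case z of (w, v) \<Rightarrow> DF w \<bullet> v)\<bar> \<le> C * (norm z)\<^sup>2"
    using quadratically_bounded_DF_inner unfolding quadratically_bounded_def by blast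
  have "\<bar>G w\<bar> \<le> 2 * C * (norm w)\<^sup>2" if "norm w \<le> R" for w
  proof -
    have "norm (w, w) \<le> 2 * R"
      using norm_Pair_le[of w w] that by simp
    then show ?thesis
      using DF_inner_le(2)[of "(w, w)"] by (simp add: G_def norm_Pair inner_commute)
  qed
  with DF_inner_le(1) show "\<exists>C\<ge>0. \<forall>w. norm w \<le> R \<longrightarrow> \<bar>G w\<bar> \<le> C * (norm w)\<^sup>2"
    by (intro exI[of _ "2 * C"]) auto
qed

lemmas integrable_F = integrable_quadratically_bounded[OF quadratically_bounded_F]
  and integrable_G = integrable_quadratically_bounded[OF quadratically_bounded_G]

lemma integrable_DF_inner:
  assumes W: "bounded_square_integrable M W" and V: "bounded_square_integrable M V"
  shows "integrable M (\<lambda>x. DF (W x) \<bullet> V x)"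
  using integrable_quadratically_bounded[OF quadratically_bounded_DF_inner
      bounded_square_integrable_lincomb[OF bounded_square_integrable_Pair_0(1)[OF W]
        bounded_square_integrable_Pair_0(2)[OF V], of 1 1]] by simp

lemma tendsto_integral_DF_inner:
  assumes W: "bounded_square_integrable M W" and V: "bounded_square_integrable M V"
    and lim: "(\<alpha> \<longlongrightarrow> a) \<F>"
  shows "((\<lambda>n. LINT x|M. DF (\<alpha> n *\<^sub>R W x) \<bullet> V x) \<longlongrightarrow> (LINT x|M. DF (a *\<^sub>R W x) \<bullet> V x)) \<F>"
  using tendsto_integral_quadratically_bounded[OF quadratically_bounded_DF_inner
      bounded_square_integrable_Pair_0(1)[OF W] bounded_square_integrable_Pair_0(2)[OF V]
      lim tendsto_const[of 1]] by simp

lemma integral_F_linearisation: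
  "\<exists>C\<ge>0. \<forall>W V. bounded_square_integrable M W \<longrightarrow> bounded_square_integrable M V
    \<longrightarrow> (AE x in M. norm (W x) \<le> R) \<longrightarrow> (AE x in M. norm (V x) \<le> R)
    \<longrightarrow> \<bar>(LINT x|M. F (W x + V x)) - (LINT x|M. F (W x)) - (LINT x|M. DF (W x) \<bullet> V x)\<bar>
      \<le> C * (LINT x|M. (norm (V x))\<^sup>2)"
proof -
  obtain C where linearisation: "0 \<le> C"
    "\<And>w h. norm w \<le> R \<Longrightarrow> norm h \<le> R \<Longrightarrow> \<bar>F (w + h) - F w - DF w \<bullet> h\<bar> \<le> C * (norm h)\<^sup>2"
    using F_linearisation by blast
  have "\<bar>(LINT x|M. F (W x + V x)) - (LINT x|M. F (W x)) - (LINT x|M. DF (W x) \<bullet> V x)\<bar>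
      \<le> C * (LINT x|M. (norm (V x))\<^sup>2)"
    if W: "bounded_square_integrable M W" and V: "bounded_square_integrable M V"
      and bounds: "AE x in M. norm (W x) \<le> R" "AE x in M. norm (V x) \<le> R" for W V
  proof -
    have "bounded_square_integrable M (\<lambda>x. W x + V x)"
      using bounded_square_integrable_lincomb[OF W V, of 1 1] by simp
    note integrable_terms = integrable_F[OF this] integrable_F[OF W] integrable_DF_inner[OF W V]
    have "\<bar>LINT x|M. F (W x + V x) - F (W x) - DF (W x) \<bullet> V x\<bar>
        \<le> (LINT x|M. \<bar>F (W x + V x) - F (W x) - DF (W x) \<bullet> V x\<bar>)"
      by (rule integral_abs_bound)
    also have "\<dots> \<le> (LINT x|M. C * (norm (V x))\<^sup>2)"
    proof (rule integral_mono_AE)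
      show "AE x in M. \<bar>F (W x + V x) - F (W x) - DF (W x) \<bullet> V x\<bar> \<le> C * (norm (V x))\<^sup>2"
        using bounds by eventually_elim (rule linearisation(2))
    qed (use integrable_terms V in \<open>auto simp: square_integrable_norm_sq bounded_square_integrableD\<close>)
    finally show ?thesis
      using integrable_terms by simp
  qed
  with linearisation(1) show ?thesis
    by blast
qed

lemma difference_quotient_F_error:
  assumes W: "bounded_square_integrable M W" and V: "bounded_square_integrable M V"
  obtains C where "\<And>t s. 0 < t \<Longrightarrow> t \<le> 2 \<Longrightarrow> 0 < s \<Longrightarrow> s \<le> 1 \<Longrightarrow>
    \<bar>((LINT x|M. F (t *\<^sub>R W x + (t * s) *\<^sub>R V x)) - (LINT x|M. F (t *\<^sub>R W x))) / (t * s)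
      - (LINT x|M. DF (t *\<^sub>R W x) \<bullet> V x)\<bar> \<le> C * (t * s)"
proof -
  obtain R where W_le: "0 \<le> R" "AE x in M. norm (W x) \<le> R"
    using bounded_square_integrable_bound[OF W] .
  obtain S where V_le: "0 \<le> S" "AE x in M. norm (V x) \<le> S"
    using bounded_square_integrable_bound[OF V] .
  obtain C where linearisation: "\<And>W V. bounded_square_integrable M W \<Longrightarrow> bounded_square_integrable M V \<Longrightarrow>
      AE x in M. norm (W x) \<le> 2 * (R + S) \<Longrightarrow> AE x in M. norm (V x) \<le> 2 * (R + S) \<Longrightarrow>
      \<bar>(LINT x|M. F (W x + V x)) - (LINT x|M. F (W x)) - (LINT x|M. DF (W x) \<bullet> V x)\<bar>
        \<le> C * (LINT x|M. (norm (V x))\<^sup>2)"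
    using integral_F_linearisation[of M "2 * (R + S)"] by blast
  show thesis
  proof (rule that)
    fix t s :: real assume ts_bounds: "0 < t" "t \<le> 2" "0 < s" "s \<le> 1"
    let ?E = "LINT x|M. (norm (V x))\<^sup>2" and ?dF = "LINT x|M. DF (t *\<^sub>R W x) \<bullet> V x"
    let ?\<Delta> = "(LINT x|M. F (t *\<^sub>R W x + (t * s) *\<^sub>R V x)) - (LINT x|M. F (t *\<^sub>R W x))"
    have ts_le: "t * s \<le> 2"
      using mult_mono[of t 2 s 1] ts_bounds by simp
    have "AE x in M. norm (t *\<^sub>R W x) \<le> 2 * (R + S)" "AE x in M. norm ((t * s) *\<^sub>R V x) \<le> 2 * (R + S)"
      using W_le(2) V_le(2)
      by (eventually_elim; use mult_mono[of t 2 _ R] mult_mono[of "t * s" 2 _ S] ts_bounds ts_le W_le(1) V_le(1) in force)+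
    from linearisation[OF bounded_square_integrable_scaleR[OF W] bounded_square_integrable_scaleR[OF V] this]
    have "\<bar>?\<Delta> - (t * s) * ?dF\<bar> / (t * s) \<le> C * ?E * (t * s)\<^sup>2 / (t * s)"
      using ts_bounds by (intro divide_right_mono) (simp_all add: power_mult_distrib mult_ac)
    also have "\<dots> = C * ?E * (t * s)"
      using ts_bounds by (simp add: power2_eq_square)
    also have "\<bar>?\<Delta> - (t * s) * ?dF\<bar> / (t * s) = \<bar>(?\<Delta> - (t * s) * ?dF) / (t * s)\<bar>"
      using ts_bounds by (simp add: abs_divide abs_mult)
    also have "(?\<Delta> - (t * s) * ?dF) / (t * s) = ?\<Delta> / (t * s) - ?dF"
      using ts_bounds by (simp add: diff_divide_distrib)
    finally show "\<bar>?\<Delta> / (t * s) - ?dF\<bar> \<le> C * ?E * (t * s)" .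
  qed
qed

lemma tendsto_difference_quotient_F:
  assumes W: "bounded_square_integrable M W" and V: "bounded_square_integrable M V"
  shows "((\<lambda>(t, s). ((LINT x|M. F (t *\<^sub>R W x + (t * s) *\<^sub>R V x)) - (LINT x|M. F (t *\<^sub>R W x))) / (t * s))
    \<longlongrightarrow> (LINT x|M. DF (W x) \<bullet> V x)) (nhds 1 \<times>\<^sub>F at_right 0)"
    (is "(?quotient \<longlongrightarrow> _) ?\<F>")
proof -
  obtain C where quotient_error: "\<And>t s. 0 < t \<Longrightarrow> t \<le> 2 \<Longrightarrow> 0 < s \<Longrightarrow> s \<le> 1 \<Longrightarrow>
    \<bar>?quotient (t, s) - (LINT x|M. DF (t *\<^sub>R W x) \<bullet> V x)\<bar> \<le> C * (t * s)"
    using difference_quotient_F_error[OF W V] by auto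
  have "\<forall>\<^sub>F t::real in nhds 1. 0 < t \<and> t \<le> 2"
    by (rule eventually_mono[OF eventually_nhds_in_open[of "{0<..<2}"]]) auto
  moreover have "\<forall>\<^sub>F s::real in at_right 0. 0 < s \<and> s \<le> 1"
    unfolding eventually_at_right_field by (intro exI[of _ 1]) simp
  ultimately have error_le: "\<forall>\<^sub>F z in ?\<F>.
      norm (?quotient z - (LINT x|M. DF (fst z *\<^sub>R W x) \<bullet> V x)) \<le> C * (fst z * snd z)"
    using quotient_error by (intro eventually_mono[OF eventually_prodI]) auto
  have t_lim: "(fst \<longlongrightarrow> 1) ?\<F>" and s_lim: "(snd \<longlongrightarrow> 0) ?\<F>"
    using filterlim_fst filterlim_mono[OF filterlim_snd at_within_le_nhds order_refl] .
  have "((\<lambda>z. C * (fst z * snd z)) \<longlongrightarrow> C * (1 * 0)) ?\<F>"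
    by (intro tendsto_intros t_lim s_lim)
  then have "((\<lambda>z. ?quotient z - (LINT x|M. DF (fst z *\<^sub>R W x) \<bullet> V x)) \<longlongrightarrow> 0) ?\<F>"
    by (intro Lim_null_comparison[OF error_le]) simp
  from tendsto_add[OF this tendsto_integral_DF_inner[OF W V t_lim]] show ?thesis
    by simp
qed

section \<open>Minimisers on the Nehari manifold\<close>

text \<open>The quadratic part of the functional enters only through its value \<open>q\<close>.\<close>

definition energy :: "'m measure \<Rightarrow> real \<Rightarrow> ('m \<Rightarrow> 'a) \<Rightarrow> real" where
  "energy M q W = q / 2 - (LINT x|M. F (W x))"

lemma tendsto_energy_difference_quotient:
  assumes W: "bounded_square_integrable M W" and V: "bounded_square_integrable M V"
    and Q: "(Q has_real_derivative 2 * D) (at 0)"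
  shows "((\<lambda>(t, s). (energy M (t\<^sup>2 * Q s) (\<lambda>x. t *\<^sub>R W x + (t * s) *\<^sub>R V x)
      - energy M (t\<^sup>2 * Q 0) (\<lambda>x. t *\<^sub>R W x)) / (t * s))
    \<longlongrightarrow> D - (LINT x|M. DF (W x) \<bullet> V x)) (nhds 1 \<times>\<^sub>F at_right 0)"
proof -
  let ?\<Delta>F = "\<lambda>t s. (LINT x|M. F (t *\<^sub>R W x + (t * s) *\<^sub>R V x)) - (LINT x|M. F (t *\<^sub>R W x))"
  have "((\<lambda>s. (Q s - Q 0) / s / 2) \<longlongrightarrow> 2 * D / 2) (at_right 0)"
    using Q unfolding DERIV_def by (intro tendsto_intros) (auto simp: filterlim_at_split)
  from filterlim_compose[OF this filterlim_snd]
  have "((\<lambda>z. fst z * ((Q (snd z) - Q 0) / snd z / 2)) \<longlongrightarrow> 1 * (2 * D / 2)) (nhds 1 \<times>\<^sub>F at_right 0)"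
    by (intro tendsto_mult filterlim_fst)
  from tendsto_diff[OF this tendsto_difference_quotient_F[OF W V]]
  have "((\<lambda>(t, s). t * ((Q s - Q 0) / s / 2) - ?\<Delta>F t s / (t * s))
      \<longlongrightarrow> D - (LINT x|M. DF (W x) \<bullet> V x)) (nhds 1 \<times>\<^sub>F at_right 0)"
    by (simp add: case_prod_unfold)
  also have "(\<lambda>(t, s). t * ((Q s - Q 0) / s / 2) - ?\<Delta>F t s / (t * s))
      = (\<lambda>(t, s). (energy M (t\<^sup>2 * Q s) (\<lambda>x. t *\<^sub>R W x + (t * s) *\<^sub>R V x)
          - energy M (t\<^sup>2 * Q 0) (\<lambda>x. t *\<^sub>R W x)) / (t * s))"
  proof (rule ext, clarify)
    fix t s :: real
    show "t * ((Q s - Q 0) / s / 2) - ?\<Delta>F t s / (t * s)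
      = (energy M (t\<^sup>2 * Q s) (\<lambda>x. t *\<^sub>R W x + (t * s) *\<^sub>R V x) - energy M (t\<^sup>2 * Q 0) (\<lambda>x. t *\<^sub>R W x)) / (t * s)"
      by (cases "t = 0"; cases "s = 0") (simp_all add: energy_def field_simps power2_eq_square)
  qed
  finally show ?thesis .
qed

lemma eventually_energy_decrease:
  assumes W: "bounded_square_integrable M W" and V: "bounded_square_integrable M V"
    and Q: "(Q has_real_derivative 2 * D) (at 0)" and less: "D < (LINT x|M. DF (W x) \<bullet> V x)"
  obtains \<epsilon> where "0 < \<epsilon>" "\<epsilon> < 1"
    "\<forall>\<^sub>F s in at_right 0. \<forall>t\<in>{1 - \<epsilon>..1 + \<epsilon>}.
      energy M (t\<^sup>2 * Q s) (\<lambda>x. t *\<^sub>R W x + (t * s) *\<^sub>R V x) < energy M (t\<^sup>2 * Q 0) (\<lambda>x. t *\<^sub>R W x)"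
proof -
  define J where "J t s = energy M (t\<^sup>2 * Q s) (\<lambda>x. t *\<^sub>R W x + (t * s) *\<^sub>R V x)" for t s
  have "\<forall>\<^sub>F (t, s) in nhds 1 \<times>\<^sub>F at_right 0. (J t s - J t 0) / (t * s) < 0"
    using order_tendstoD(2)[OF tendsto_energy_difference_quotient[OF W V Q], of 0] less
    by (simp add: J_def case_prod_unfold)
  then obtain T S where T: "eventually T (nhds 1)" and S: "eventually S (at_right 0)"
    and neg: "\<And>t s. T t \<Longrightarrow> S s \<Longrightarrow> (J t s - J t 0) / (t * s) < 0"
    unfolding eventually_prod_filter by auto
  obtain \<delta> where \<delta>: "0 < \<delta>" "\<And>t. dist t 1 < \<delta> \<Longrightarrow> T t"
    using T unfolding eventually_nhds_metric by blast
  define \<epsilon> where "\<epsilon> = min (\<delta> / 2) (1 / 2)"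
  have \<epsilon>: "0 < \<epsilon>" "\<epsilon> < 1" "\<epsilon> < \<delta>"
    using \<delta>(1) by (auto simp: \<epsilon>_def)
  have "\<forall>\<^sub>F s in at_right 0. \<forall>t\<in>{1 - \<epsilon>..1 + \<epsilon>}. J t s < J t 0"
    using S eventually_at_right_less[of "0::real"]
  proof eventually_elim
    case (elim s)
    show ?case
    proof
      fix t assume t: "t \<in> {1 - \<epsilon>..1 + \<epsilon>}"
      then have "0 < t" "T t"
        using \<epsilon> \<delta>(2)[of t] by (auto simp: dist_real_def)
      with neg[of t s] elim show "J t s < J t 0"
        by (simp add: divide_less_0_iff zero_less_mult_iff mult_less_0_iff)
    qed
  qed
  with \<epsilon>(1,2) show thesis
    by (intro that[of \<epsilon>]) (simp_all add: J_def)
qed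

lemma energy_nonneg:
  assumes W: "bounded_square_integrable M W" and nonneg: "0 \<le> (LINT x|M. G (W x))"
  shows "0 \<le> energy M (LINT x|M. G (W x)) W"
proof -
  have "(LINT x|M. F (W x)) \<le> (LINT x|M. G (W x) / (p + 2))"
    using integrable_F[OF W] integrable_G[OF W] F_le_G by (intro integral_mono) auto
  also have "\<dots> = (LINT x|M. G (W x)) / (p + 2)"
    by simp
  also have "\<dots> \<le> (LINT x|M. G (W x)) / 2"
    using nonneg p_pos by (intro divide_left_mono) auto
  finally show ?thesis
    by (simp add: energy_def)
qed

context
  fixes M :: "'m measure" and W :: "'m \<Rightarrow> 'a"
  assumes W: "bounded_square_integrable M W" and pos: "0 < (LINT x|M. G (W x))"
begin

lemma integral_G_ray_gt:
  assumes "1 < t"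
  shows "t\<^sup>2 * (LINT x|M. G (W x)) < (LINT x|M. G (t *\<^sub>R W x))"
proof -
  have "t powr 2 < t powr (p + 2)"
    using assms p_pos by (intro powr_less_mono) auto
  then have "t\<^sup>2 * (LINT x|M. G (W x)) < t powr (p + 2) * (LINT x|M. G (W x))"
    using assms pos by (intro mult_strict_right_mono) auto
  also have "\<dots> = (LINT x|M. t powr (p + 2) * G (W x))"
    by simp
  also have "\<dots> \<le> (LINT x|M. G (t *\<^sub>R W x))"
    using assms W by (intro integral_mono G_scale_ge integrable_mult_right integrable_G
        bounded_square_integrable_scaleR) auto
  finally show ?thesis .
qed

lemma integral_G_ray_less:
  assumes "0 < t" "t < 1"
  shows "(LINT x|M. G (t *\<^sub>R W x)) < t\<^sup>2 * (LINT x|M. G (W x))"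
proof -
  have "(LINT x|M. G (t *\<^sub>R W x)) \<le> (LINT x|M. t powr (p + 2) * G (W x))"
    using assms W by (intro integral_mono G_scale_le integrable_mult_right integrable_G
        bounded_square_integrable_scaleR) auto
  also have "\<dots> = t powr (p + 2) * (LINT x|M. G (W x))"
    by simp
  also have "t powr (p + 2) < t powr 2"
    using assms p_pos by (intro powr_less_mono') auto
  then have "t powr (p + 2) * (LINT x|M. G (W x)) < t\<^sup>2 * (LINT x|M. G (W x))"
    using assms pos by (intro mult_strict_right_mono) auto
  finally show ?thesis .
qed

lemma energy_ray_le:
  assumes t: "0 < t"
  shows "energy M (t\<^sup>2 * (LINT x|M. G (W x))) (\<lambda>x. t *\<^sub>R W x) \<le> energy M (LINT x|M. G (W x)) W"
proof -
  let ?I = "LINT x|M. G (W x)"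
  note integrable_terms = integrable_F[OF W] integrable_G[OF W]
    integrable_F[OF bounded_square_integrable_scaleR[OF W, of t]]
  have "?I * ((t\<^sup>2 - 1) / 2) \<le> ?I * ((t powr (p + 2) - 1) / (p + 2))"
    using pos powr_minus_one_div_mono[OF t, of 2 "p + 2"] p_pos t by (intro mult_left_mono) auto
  also have "\<dots> = (LINT x|M. G (W x) * (t powr (p + 2) - 1) / (p + 2))"
    by simp
  also have "\<dots> \<le> (LINT x|M. F (t *\<^sub>R W x) - F (W x))"
    using integrable_terms F_scale_ge[OF t] by (intro integral_mono) auto
  also have "\<dots> = (LINT x|M. F (t *\<^sub>R W x)) - (LINT x|M. F (W x))"
    using integrable_terms by simp
  finally show ?thesis
    by (simp add: energy_def field_simps)
qed

lemma nehari_projection: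
  assumes V: "bounded_square_integrable M V" and Q: "(Q \<longlongrightarrow> (LINT x|M. G (W x))) (at_right 0)"
    and \<epsilon>: "0 < \<epsilon>" "\<epsilon> < 1"
  shows "\<forall>\<^sub>F s in at_right 0. \<exists>t\<in>{1 - \<epsilon>..1 + \<epsilon>}. t\<^sup>2 * Q s = (LINT x|M. G (t *\<^sub>R W x + (t * s) *\<^sub>R V x))"
proof -
  define P where "P t s = t\<^sup>2 * Q s - (LINT x|M. G (t *\<^sub>R W x + (t * s) *\<^sub>R V x))" for t s
  have "((\<lambda>s. P t s) \<longlongrightarrow> t\<^sup>2 * (LINT x|M. G (W x)) - (LINT x|M. G (t *\<^sub>R W x))) (at_right 0)" for t
  proof -
    have "((\<lambda>s. t * s) \<longlongrightarrow> 0) (at_right 0)"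
      by (auto intro!: tendsto_eq_intros)
    from tendsto_integral_quadratically_bounded[OF quadratically_bounded_G W V tendsto_const[of t] this]
    show ?thesis
      unfolding P_def by (intro tendsto_intros Q) simp
  qed
  from order_tendstoD[OF this[of "1 - \<epsilon>"]] order_tendstoD[OF this[of "1 + \<epsilon>"]]
  have "\<forall>\<^sub>F s in at_right 0. 0 < P (1 - \<epsilon>) s" "\<forall>\<^sub>F s in at_right 0. P (1 + \<epsilon>) s < 0"
    using integral_G_ray_gt[of "1 + \<epsilon>"] integral_G_ray_less[of "1 - \<epsilon>"] \<epsilon> by auto
  then show ?thesis
  proof eventually_elim
    case (elim s)
    have "continuous_on {1 - \<epsilon>..1 + \<epsilon>} (\<lambda>t. P t s)"
      unfolding P_def continuous_on_def
      by (intro ballI tendsto_intros tendsto_integral_quadratically_bounded[OF quadratically_bounded_G W V])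
    then obtain t where "1 - \<epsilon> \<le> t" "t \<le> 1 + \<epsilon>" "P t s = 0"
      using IVT2'[of "\<lambda>t. P t s" "1 + \<epsilon>" 0 "1 - \<epsilon>"] elim \<epsilon> by auto
    then show ?case
      by (auto simp: P_def)
  qed
qed

text \<open>If the first variation were negative, projecting \<open>W + s V\<close> back to the Nehari manifold would
  lower the energy: the projection costs nothing, since on the ray through \<open>W\<close> the energy is
  maximal at \<open>W\<close> itself.\<close>

lemma nehari_minimiser_first_variation_le:
  assumes V: "bounded_square_integrable M V"
    and Q: "Q 0 = (LINT x|M. G (W x))" "(Q has_real_derivative 2 * D) (at 0)"
    and minimal: "\<And>t s. 0 < t \<Longrightarrow> 0 < Q s \<Longrightarrow> t\<^sup>2 * Q s = (LINT x|M. G (t *\<^sub>R W x + (t * s) *\<^sub>R V x)) \<Longrightarrow>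
      energy M (Q 0) W \<le> energy M (t\<^sup>2 * Q s) (\<lambda>x. t *\<^sub>R W x + (t * s) *\<^sub>R V x)"
  shows "(LINT x|M. DF (W x) \<bullet> V x) \<le> D"
proof (rule ccontr)
  assume "\<not> ?thesis"
  then have less: "D < (LINT x|M. DF (W x) \<bullet> V x)"
    by simp
  obtain \<epsilon> where \<epsilon>: "0 < \<epsilon>" "\<epsilon> < 1"
    and decrease: "\<forall>\<^sub>F s in at_right 0. \<forall>t\<in>{1 - \<epsilon>..1 + \<epsilon>}.
      energy M (t\<^sup>2 * Q s) (\<lambda>x. t *\<^sub>R W x + (t * s) *\<^sub>R V x) < energy M (t\<^sup>2 * Q 0) (\<lambda>x. t *\<^sub>R W x)"
    using eventually_energy_decrease[OF W V Q(2) less] .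
  have Q_lim: "(Q \<longlongrightarrow> (LINT x|M. G (W x))) (at_right 0)"
    using DERIV_isCont[OF Q(2)] Q(1) by (simp add: isCont_def filterlim_at_split)
  have "\<forall>\<^sub>F s in at_right 0. 0 < Q s"
    using order_tendstoD(1)[OF Q_lim pos] .
  with nehari_projection[OF V Q_lim \<epsilon>] decrease have "\<forall>\<^sub>F s in at_right (0::real). False"
  proof eventually_elim
    case (elim s)
    then obtain t where t: "t \<in> {1 - \<epsilon>..1 + \<epsilon>}" "t\<^sup>2 * Q s = (LINT x|M. G (t *\<^sub>R W x + (t * s) *\<^sub>R V x))"
      by blast
    then have "0 < t"
      using \<epsilon> by simp
    then have "energy M (Q 0) W \<le> energy M (t\<^sup>2 * Q s) (\<lambda>x. t *\<^sub>R W x + (t * s) *\<^sub>R V x)"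
      using elim(3) t(2) by (rule minimal)
    also have "\<dots> < energy M (t\<^sup>2 * Q 0) (\<lambda>x. t *\<^sub>R W x)"
      using elim(2) t(1) by blast
    also have "\<dots> \<le> energy M (Q 0) W"
      using energy_ray_le[OF \<open>0 < t\<close>] by (simp add: Q(1))
    finally show False
      by simp
  qed
  then show False
    by simp
qed

lemma nehari_minimiser_first_variation_eq:
  assumes V: "bounded_square_integrable M V"
    and Q: "Q 0 = (LINT x|M. G (W x))" "(Q has_real_derivative 2 * D) (at 0)"
    and minimal: "\<And>t s. 0 < t \<Longrightarrow> 0 < Q s \<Longrightarrow> t\<^sup>2 * Q s = (LINT x|M. G (t *\<^sub>R W x + (t * s) *\<^sub>R V x)) \<Longrightarrow>
      energy M (Q 0) W \<le> energy M (t\<^sup>2 * Q s) (\<lambda>x. t *\<^sub>R W x + (t * s) *\<^sub>R V x)"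
  shows "(LINT x|M. DF (W x) \<bullet> V x) = D"
proof (rule antisym)
  show "(LINT x|M. DF (W x) \<bullet> V x) \<le> D"
    using V Q minimal by (rule nehari_minimiser_first_variation_le)
  have "((\<lambda>s. Q (- s)) has_real_derivative 2 * - D) (at 0)"
    using Q(2) DERIV_mirror[of Q "2 * D" 0] by simp
  then have "(LINT x|M. DF (W x) \<bullet> - V x) \<le> - D"
    using bounded_square_integrable_scaleR[OF V, of "-1"] Q(1) minimal[of _ "- _"]
    by (intro nehari_minimiser_first_variation_le[where Q="\<lambda>s. Q (- s)"]) simp_all
  then show "D \<le> (LINT x|M. DF (W x) \<bullet> V x)"
    by simp
qed

end

end

section \<open>Jets of functions in \<open>H\<^sup>2\<close>\<close>

lemma H2D:
  assumes "H2 u"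
  shows "square_integrable lborel u" "square_integrable lborel (wd u)" "square_integrable lborel (wd (wd u))"
    and "weak_deriv u (wd u)" "weak_deriv (wd u) (wd (wd u))"
proof -
  obtain u1 u2 where sq_ints: "sq_int u" "sq_int u1" "sq_int u2" and u: "weak_deriv u u1" "weak_deriv u1 u2"
    using assms unfolding H2_def by blast
  note wd = wd_AE_eq[OF u(1)] and wd_wd = wd_wd_AE_eq[OF u]
  show "weak_deriv u (wd u)" "weak_deriv (wd u) (wd (wd u))"
    using wd wd_wd by blast+
  show "square_integrable lborel u"
    using sq_ints(1) by (simp add: sq_int_iff_square_integrable)
  show "square_integrable lborel (wd u)"
    using sq_ints(2) wd(2) wd_borel[OF u(1)] unfolding sq_int_iff_square_integrable
    by (rule square_integrable_cong_AE)
  show "square_integrable lborel (wd (wd u))"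
    using sq_ints(3) wd_wd(2) wd_borel[OF wd_wd(1)] unfolding sq_int_iff_square_integrable
    by (rule square_integrable_cong_AE)
qed

lemma H2_lincomb:
  assumes u: "H2 u" and v: "H2 v"
  shows "H2 (\<lambda>x. \<alpha> * u x + \<beta> * v x)"
    and "AE x in lborel. wd (\<lambda>x. \<alpha> * u x + \<beta> * v x) x = \<alpha> * wd u x + \<beta> * wd v x"
    and "AE x in lborel. wd (wd (\<lambda>x. \<alpha> * u x + \<beta> * v x)) x = \<alpha> * wd (wd u) x + \<beta> * wd (wd v) x"
proof -
  have sq_int_lincomb: "sq_int (\<lambda>x. \<alpha> * f x + \<beta> * g x)"
    if "square_integrable lborel f" "square_integrable lborel g" for f g
    using square_integrable_lincomb[OF that, of \<alpha> \<beta>] by (simp add: sq_int_iff_square_integrable)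
  have weak: "weak_deriv (\<lambda>x. \<alpha> * u x + \<beta> * v x) (\<lambda>x. \<alpha> * wd u x + \<beta> * wd v x)"
    "weak_deriv (\<lambda>x. \<alpha> * wd u x + \<beta> * wd v x) (\<lambda>x. \<alpha> * wd (wd u) x + \<beta> * wd (wd v) x)"
    by (intro weak_deriv_lincomb H2D u v)+
  show "H2 (\<lambda>x. \<alpha> * u x + \<beta> * v x)"
    unfolding H2_def using weak sq_int_lincomb[OF H2D(1)[OF u] H2D(1)[OF v]]
      sq_int_lincomb[OF H2D(2)[OF u] H2D(2)[OF v]]
      sq_int_lincomb[OF H2D(3)[OF u] H2D(3)[OF v]] by blast
  show "AE x in lborel. wd (\<lambda>x. \<alpha> * u x + \<beta> * v x) x = \<alpha> * wd u x + \<beta> * wd v x"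
    "AE x in lborel. wd (wd (\<lambda>x. \<alpha> * u x + \<beta> * v x)) x = \<alpha> * wd (wd u) x + \<beta> * wd (wd v) x"
    using wd_AE_eq(2)[OF weak(1)] wd_wd_AE_eq(2)[OF weak] .
qed

lemma wd_AE_eq_0:
  assumes "H2 u" "AE x in lborel. u x = 0"
  shows "AE x in lborel. wd u x = 0" "AE x in lborel. wd (wd u) x = 0"
proof -
  have zero: "weak_deriv (\<lambda>_. 0) (\<lambda>_. 0)"
    by (simp add: weak_deriv_def loc_integrable_continuous)
  moreover have "weak_deriv u (\<lambda>_. 0)"
  proof (rule weak_deriv_cong_AE[OF zero])
    show "AE x in lborel. 0 = u x"
      using assms(2) by eventually_elim simp
  qed (use H2D(1)[OF assms(1)] square_integrable_borel in blast)
  ultimately show "AE x in lborel. wd u x = 0" "AE x in lborel. wd (wd u) x = 0"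
    using wd_AE_eq(2) wd_wd_AE_eq(2) by blast+
qed

lemma vec4_nth [simp]:
  "vec4 x1 x2 x3 x4 $ 1 = x1" "vec4 x1 x2 x3 x4 $ 2 = x2" "vec4 x1 x2 x3 x4 $ 3 = x3" "vec4 x1 x2 x3 x4 $ 4 = x4"
  by (simp_all add: vec4_def vector_def)

lemma vec4_eq_sum_axis: "vec4 x1 x2 x3 x4 = x1 *\<^sub>R axis 1 1 + x2 *\<^sub>R axis 2 1 + x3 *\<^sub>R axis 3 1 + x4 *\<^sub>R axis 4 1"
  by (simp add: vec_eq_iff forall_4 axis_def)

text \<open>The first component is the argument of \<open>F\<close>; only the quadratic part of the functional
  sees the second derivatives.\<close>

definition jet :: "(real \<Rightarrow> real) \<Rightarrow> (real \<Rightarrow> real) \<Rightarrow> real \<Rightarrow> (real^4) \<times> real \<times> real" where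
  "jet \<psi> v x = (vec4 (\<psi> x) (wd \<psi> x) (v x) (wd v x), wd (wd \<psi>) x, wd (wd v) x)"

lemma norm_jet_sq:
  "(norm (jet \<psi> v x))\<^sup>2 = ((\<psi> x)\<^sup>2 + (wd \<psi> x)\<^sup>2 + (wd (wd \<psi>) x)\<^sup>2) + ((v x)\<^sup>2 + (wd v x)\<^sup>2 + (wd (wd v) x)\<^sup>2)"
  by (simp add: jet_def norm_Pair norm_vec_def L2_set_def sum_4)

lemma square_integrable_jet:
  assumes "H2 \<psi>" "H2 v"
  shows "square_integrable lborel (jet \<psi> v)"
proof -
  note derivs = H2D[OF assms(1)] H2D[OF assms(2)]
  note [measurable] = derivs(1-3,6-8)[THEN square_integrable_borel]
  have "jet \<psi> v \<in> borel_measurable lborel"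
    unfolding jet_def[abs_def] vec4_eq_sum_axis by measurable
  moreover have "integrable lborel (\<lambda>x. (norm (jet \<psi> v x))\<^sup>2)"
    unfolding norm_jet_sq using derivs by (simp add: square_integrable_def)
  ultimately show ?thesis
    by (simp add: square_integrable_def)
qed

lemma X_norm_nonneg: "0 \<le> X_norm \<psi> v"
  unfolding X_norm_def H2_norm_sq_def
  by (intro real_sqrt_ge_zero add_nonneg_nonneg integral_nonneg_AE) auto

lemma integral_norm_jet_sq:
  assumes "H2 \<psi>" "H2 v"
  shows "(LINT x|lborel. (norm (jet \<psi> v x))\<^sup>2) = (X_norm \<psi> v)\<^sup>2"
proof -
  have integrable_sum_sq: "integrable lborel (\<lambda>x. (u x)\<^sup>2 + (wd u x)\<^sup>2 + (wd (wd u) x)\<^sup>2)" if "H2 u" for u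
    using H2D(1-3)[OF that] by (simp add: square_integrable_def)
  have "(LINT x|lborel. (norm (jet \<psi> v x))\<^sup>2) = H2_norm_sq \<psi> + H2_norm_sq v"
    unfolding norm_jet_sq H2_norm_sq_def
    using integrable_sum_sq[OF assms(1)] integrable_sum_sq[OF assms(2)] by (rule Bochner_Integration.integral_add)
  also have "\<dots> = (X_norm \<psi> v)\<^sup>2"
    using X_norm_nonneg[of \<psi> v] by (simp add: X_norm_def)
  finally show ?thesis .
qed

lemma integral_norm_jet_fst_sq_le:
  assumes in_H2: "H2 \<psi>" "H2 v"
  shows "(LINT x|lborel. (norm (fst (jet \<psi> v x)))\<^sup>2) \<le> (X_norm \<psi> v)\<^sup>2"
  unfolding integral_norm_jet_sq[OF in_H2, symmetric]
proof (intro integral_mono power_mono)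
  show "integrable lborel (\<lambda>x. (norm (fst (jet \<psi> v x)))\<^sup>2)" "integrable lborel (\<lambda>x. (norm (jet \<psi> v x))\<^sup>2)"
    by (intro square_integrable_norm_sq square_integrable_fst square_integrable_jet in_H2)+
  show "norm (fst (jet \<psi> v x)) \<le> norm (jet \<psi> v x)" for x
    using norm_fst_le[of "fst (jet \<psi> v x)" "snd (jet \<psi> v x)"] by simp
qed simp

lemma jet_fst_AE_le:
  assumes in_H2: "H2 \<psi>" "H2 v"
  shows "AE x in lborel. norm (fst (jet \<psi> v x)) \<le> 44 * X_norm \<psi> v"
proof -
  have component_le: "AE x in lborel. \<bar>u x\<bar> \<le> 11 * X_norm \<psi> v"
    if u: "weak_deriv u u1" "square_integrable lborel u" "square_integrable lborel u1"
      and sum_sq_le: "\<And>x. (u x)\<^sup>2 + (u1 x)\<^sup>2 \<le> (norm (jet \<psi> v x))\<^sup>2" for u u1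
  proof -
    have "(LINT x|lborel. (u x)\<^sup>2 + (u1 x)\<^sup>2) \<le> (LINT x|lborel. (norm (jet \<psi> v x))\<^sup>2)"
      using u square_integrable_norm_sq[OF square_integrable_jet[OF in_H2]] sum_sq_le
      by (intro integral_mono) (auto simp: square_integrable_def)
    then have "sqrt (LINT x|lborel. (u x)\<^sup>2 + (u1 x)\<^sup>2) \<le> X_norm \<psi> v"
      unfolding integral_norm_jet_sq[OF in_H2] using X_norm_nonneg by (rule real_le_lsqrt[rotated])
    then show ?thesis
      using H1_embedding[OF u(1)] u(2,3) unfolding sq_int_iff_square_integrable
      by (auto elim!: eventually_mono)
  qed
  note derivs = H2D[OF in_H2(1)] H2D[OF in_H2(2)]
  have "AE x in lborel. \<bar>\<psi> x\<bar> \<le> 11 * X_norm \<psi> v" "AE x in lborel. \<bar>wd \<psi> x\<bar> \<le> 11 * X_norm \<psi> v"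
    "AE x in lborel. \<bar>v x\<bar> \<le> 11 * X_norm \<psi> v" "AE x in lborel. \<bar>wd v x\<bar> \<le> 11 * X_norm \<psi> v"
    using component_le[OF derivs(4,1,2)] component_le[OF derivs(5,2,3)]
      component_le[OF derivs(9,6,7)] component_le[OF derivs(10,7,8)] by (simp_all add: norm_jet_sq)
  then show ?thesis
  proof eventually_elim
    case (elim x)
    have "norm (fst (jet \<psi> v x)) \<le> \<bar>\<psi> x\<bar> + \<bar>wd \<psi> x\<bar> + \<bar>v x\<bar> + \<bar>wd v x\<bar>"
      using norm_le_l1_cart[of "fst (jet \<psi> v x)"] by (simp add: jet_def sum_4)
    with elim show ?case
      by linarith
  qed
qed

lemma bounded_square_integrable_jet_fst:
  assumes "H2 \<psi>" "H2 v"
  shows "bounded_square_integrable lborel (\<lambda>x. fst (jet \<psi> v x))"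
  using square_integrable_fst[OF square_integrable_jet[OF assms]] jet_fst_AE_le[OF assms]
  unfolding bounded_square_integrable_def by blast

lemma jet_lincomb:
  assumes "H2 \<psi>" "H2 v" "H2 h" "H2 k"
  shows "AE x in lborel. jet (\<lambda>x. \<alpha> * \<psi> x + \<beta> * h x) (\<lambda>x. \<alpha> * v x + \<beta> * k x) x
    = \<alpha> *\<^sub>R jet \<psi> v x + \<beta> *\<^sub>R jet h k x"
  using H2_lincomb(2,3)[OF assms(1,3), of \<alpha> \<beta>] H2_lincomb(2,3)[OF assms(2,4), of \<alpha> \<beta>]
  by eventually_elim (simp add: jet_def vec4_eq_sum_axis algebra_simps)

lemma integral_jet_lincomb:
  fixes f :: "(real^4) \<times> real \<times> real \<Rightarrow> real"
  assumes f: "f \<in> borel_measurable borel" and in_H2: "H2 \<psi>" "H2 v" "H2 h" "H2 k"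
  shows "(LINT x|lborel. f (jet (\<lambda>x. \<alpha> * \<psi> x + \<beta> * h x) (\<lambda>x. \<alpha> * v x + \<beta> * k x) x))
    = (LINT x|lborel. f (\<alpha> *\<^sub>R jet \<psi> v x + \<beta> *\<^sub>R jet h k x))"
proof (rule integral_cong_AE)
  note [measurable] = f square_integrable_jet[OF in_H2(1,2), THEN square_integrable_borel]
    square_integrable_jet[OF in_H2(3,4), THEN square_integrable_borel]
    square_integrable_jet[OF H2_lincomb(1)[OF in_H2(1,3)] H2_lincomb(1)[OF in_H2(2,4)], THEN square_integrable_borel]
  show "(\<lambda>x. f (jet (\<lambda>x. \<alpha> * \<psi> x + \<beta> * h x) (\<lambda>x. \<alpha> * v x + \<beta> * k x) x)) \<in> borel_measurable lborel"
    "(\<lambda>x. f (\<alpha> *\<^sub>R jet \<psi> v x + \<beta> *\<^sub>R jet h k x)) \<in> borel_measurable lborel"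
    by measurable
qed (use jet_lincomb[OF in_H2, of \<alpha> \<beta>] in \<open>auto elim: eventually_mono\<close>)

lemma jet_AE_eq_0:
  assumes "H2 \<psi>" "H2 v" "X_zero \<psi> v"
  shows "AE x in lborel. jet \<psi> v x = 0"
proof -
  have zero: "AE x in lborel. \<psi> x = 0" "AE x in lborel. v x = 0"
    using assms(3) unfolding X_zero_def by auto
  from zero wd_AE_eq_0[OF assms(1) zero(1)] wd_AE_eq_0[OF assms(2) zero(2)] show ?thesis
    by eventually_elim (simp add: jet_def vec4_eq_sum_axis zero_prod_def)
qed

section \<open>The quadratic form\<close>

definition qform :: "real \<Rightarrow> real \<Rightarrow> real \<Rightarrow> real \<Rightarrow> real \<Rightarrow> real \<Rightarrow> real
    \<Rightarrow> (real^4) \<times> real \<times> real \<Rightarrow> (real^4) \<times> real \<times> real \<Rightarrow> real" where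
  "qform a a2 c c2 b b2 \<omega> = (\<lambda>(w, r, s) (w', r', s').
     w $ 1 * w' $ 1 - c * (w $ 2 * w' $ 2) + c2 * (r * r')
     + w $ 3 * w' $ 3 - a * (w $ 4 * w' $ 4) + a2 * (s * s')
     - \<omega> * ((w $ 1 * w' $ 3 + w $ 3 * w' $ 1) + b * (w $ 2 * w' $ 4 + w $ 4 * w' $ 2)
        + b2 * (r * s' + s * r')))"

lemma bounded_bilinear_qform: "bounded_bilinear (qform a a2 c c2 b b2 \<omega>)"
  unfolding bilinear_conv_bounded_bilinear[symmetric] bilinear_def
  by (auto intro!: linearI simp: qform_def algebra_simps)

lemma qform_sym: "qform a a2 c c2 b b2 \<omega> y z = qform a a2 c c2 b b2 \<omega> z y"
  by (simp add: qform_def case_prod_unfold algebra_simps)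

lemma binary_form_positive_definite:
  fixes A D m x y :: real
  assumes "\<bar>m\<bar> < A" "\<bar>m\<bar> < D"
  shows "0 \<le> A * x\<^sup>2 + D * y\<^sup>2 - 2 * m * (x * y)"
    and "A * x\<^sup>2 + D * y\<^sup>2 - 2 * m * (x * y) = 0 \<Longrightarrow> x = 0 \<and> y = 0"
proof -
  have "2 * \<bar>x * y\<bar> \<le> x\<^sup>2 + y\<^sup>2"
    using zero_le_power2[of "\<bar>x\<bar> - \<bar>y\<bar>"] by (simp add: power2_diff abs_mult)
  then have "\<bar>m\<bar> * (2 * \<bar>x * y\<bar>) \<le> \<bar>m\<bar> * (x\<^sup>2 + y\<^sup>2)"
    by (intro mult_left_mono) auto
  moreover have "2 * m * (x * y) \<le> \<bar>m\<bar> * (2 * \<bar>x * y\<bar>)"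
    using abs_ge_self[of "2 * m * (x * y)"] by (simp add: abs_mult mult_ac)
  ultimately have diagonal_le: "(A - \<bar>m\<bar>) * x\<^sup>2 + (D - \<bar>m\<bar>) * y\<^sup>2 \<le> A * x\<^sup>2 + D * y\<^sup>2 - 2 * m * (x * y)"
    by (simp add: algebra_simps)
  have nonneg: "0 \<le> (A - \<bar>m\<bar>) * x\<^sup>2" "0 \<le> (D - \<bar>m\<bar>) * y\<^sup>2"
    using assms by auto
  with diagonal_le show "0 \<le> A * x\<^sup>2 + D * y\<^sup>2 - 2 * m * (x * y)"
    by linarith
  assume "A * x\<^sup>2 + D * y\<^sup>2 - 2 * m * (x * y) = 0"
  with diagonal_le nonneg have "(A - \<bar>m\<bar>) * x\<^sup>2 = 0" "(D - \<bar>m\<bar>) * y\<^sup>2 = 0"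
    by linarith+
  with assms show "x = 0 \<and> y = 0"
    by auto
qed

lemma qform_positive_definite:
  assumes "b > 0" "b2 > 0" "\<bar>\<omega>\<bar> < Min {1, -a / b, -c / b, a2 / b2, c2 / b2}"
  shows "0 \<le> qform a a2 c c2 b b2 \<omega> z z" and "qform a a2 c c2 b b2 \<omega> z z = 0 \<longleftrightarrow> z = 0"
proof -
  obtain w r s where z: "z = (w, r, s)"
    by (cases z)
  have \<omega>: "\<bar>\<omega>\<bar> < 1" "\<bar>\<omega> * b\<bar> < - a" "\<bar>\<omega> * b\<bar> < - c" "\<bar>\<omega> * b2\<bar> < a2" "\<bar>\<omega> * b2\<bar> < c2"
    using assms pos_less_divide_eq[of b "\<bar>\<omega>\<bar>" "- a"] pos_less_divide_eq[of b "\<bar>\<omega>\<bar>" "- c"]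
    by (auto simp: abs_mult pos_less_divide_eq)
  note forms = binary_form_positive_definite[OF \<omega>(1,1), of "w $ 1" "w $ 3"]
    binary_form_positive_definite[OF \<omega>(3,2), of "w $ 2" "w $ 4"] binary_form_positive_definite[OF \<omega>(5,4), of r s]
  have qform_eq: "qform a a2 c c2 b b2 \<omega> z z =
      (1 * (w $ 1)\<^sup>2 + 1 * (w $ 3)\<^sup>2 - 2 * \<omega> * (w $ 1 * w $ 3))
      + (- c * (w $ 2)\<^sup>2 + - a * (w $ 4)\<^sup>2 - 2 * (\<omega> * b) * (w $ 2 * w $ 4))
      + (c2 * r\<^sup>2 + a2 * s\<^sup>2 - 2 * (\<omega> * b2) * (r * s))"
    by (simp add: z qform_def power2_eq_square algebra_simps)
  show "0 \<le> qform a a2 c c2 b b2 \<omega> z z"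
    unfolding qform_eq by (intro add_nonneg_nonneg forms(1,3,5))
  show "qform a a2 c c2 b b2 \<omega> z z = 0 \<longleftrightarrow> z = 0"
  proof
    assume "qform a a2 c c2 b b2 \<omega> z z = 0"
    then have "w $ 1 = 0 \<and> w $ 3 = 0" "w $ 2 = 0 \<and> w $ 4 = 0" "r = 0 \<and> s = 0"
      unfolding qform_eq using forms
      by (simp_all only: add_nonneg_eq_0_iff add_nonneg_nonneg)
    then show "z = 0"
      by (simp add: z vec_eq_iff forall_4 zero_prod_def)
  qed (simp add: qform_def zero_prod_def)
qed

lemma Iw_eq_integral_qform:
  assumes "H2 \<psi>" "H2 v"
  shows "Iw a a2 c c2 b b2 \<omega> \<psi> v = (LINT x|lborel. qform a a2 c c2 b b2 \<omega> (jet \<psi> v x) (jet \<psi> v x))"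
proof -
  note derivs = H2D(1-3)[OF assms(1)] H2D(1-3)[OF assms(2)]
  have mult: "integrable lborel (\<lambda>x. f x * g x)" if "square_integrable lborel f" "square_integrable lborel g"
    for f g :: "real \<Rightarrow> real"
    using that by (rule integrable_bounded_bilinear[OF bounded_bilinear_mult])
  note integrable_terms = derivs[THEN square_integrable_norm_sq, simplified] mult[OF derivs(1,4)]
    mult[OF derivs(2,5)] mult[OF derivs(3,6)]
  have "Iw a a2 c c2 b b2 \<omega> \<psi> v = (LINT x|lborel. ((\<psi> x)\<^sup>2 - c * (wd \<psi> x)\<^sup>2 + c2 * (wd (wd \<psi>) x)\<^sup>2
      + (v x)\<^sup>2 - a * (wd v x)\<^sup>2 + a2 * (wd (wd v) x)\<^sup>2)
      - 2 * \<omega> * (\<psi> x * v x + b * wd \<psi> x * wd v x + b2 * wd (wd \<psi>) x * wd (wd v) x))"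
    unfolding Iw_def I1_def I2_def using integrable_terms by (simp add: mult.assoc)
  also have "\<dots> = (LINT x|lborel. qform a a2 c c2 b b2 \<omega> (jet \<psi> v x) (jet \<psi> v x))"
    by (intro Bochner_Integration.integral_cong) (auto simp: qform_def jet_def power2_eq_square algebra_simps)
  finally show ?thesis .
qed

section \<open>The nonlinearity\<close>

lemma has_derivative_grad:
  fixes f :: "real^4 \<Rightarrow> real"
  assumes "f differentiable (at w)"
  shows "(f has_derivative (\<lambda>h. grad f w \<bullet> h)) (at w)"
proof -
  let ?D = "frechet_derivative f (at w)"
  have D: "(f has_derivative ?D) (at w)"
    using assms frechet_derivative_works by blast
  then have linear: "linear ?D"
    by (rule has_derivative_linear)
  have "?D h = grad f w \<bullet> h" for h
  proof -
    have "?D h = ?D (\<Sum>i\<in>UNIV. h $ i *\<^sub>R axis i 1)"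
      using basis_expansion[of h] by (simp add: scalar_mult_eq_scaleR)
    also have "\<dots> = (\<Sum>i\<in>UNIV. h $ i *\<^sub>R ?D (axis i 1))"
      using linear by (simp add: linear_sum linear_scale)
    also have "\<dots> = grad f w \<bullet> h"
      by (simp add: grad_def inner_vec_def mult.commute)
    finally show ?thesis .
  qed
  then have "?D = (\<lambda>h. grad f w \<bullet> h)" ..
  with D show ?thesis
    by simp
qed

lemma C2_R4_has_derivative:
  assumes "C2_R4 F"
  shows "(F has_derivative (\<lambda>h. grad F w \<bullet> h)) (at w)"
    and "(grad F has_derivative (\<lambda>h. hess F w *v h)) (at w)"
    and "(Gfun F has_derivative (\<lambda>h. grad (Gfun F) w \<bullet> h)) (at w)"
proof -
  show "(F has_derivative (\<lambda>h. grad F w \<bullet> h)) (at w)"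
    using assms has_derivative_grad unfolding C2_R4_def by blast
  show grad: "(grad F has_derivative (\<lambda>h. hess F w *v h)) (at w)"
    using assms jacobian_works unfolding C2_R4_def hess_def by blast
  have "Gfun F differentiable (at w)"
    unfolding Gfun_def[abs_def] differentiable_def
    using has_derivative_inner[OF has_derivative_ident grad] by blast
  then show "(Gfun F has_derivative (\<lambda>h. grad (Gfun F) w \<bullet> h)) (at w)"
    by (rule has_derivative_grad)
qed

lemma C2_R4_grad_Lipschitz:
  assumes F: "C2_R4 F"
  shows "\<exists>C. C-lipschitz_on (cball 0 R) (grad F)"
proof -
  have "bounded (hess F ` cball 0 R)"
    using F unfolding C2_R4_def
    by (intro compact_imp_bounded compact_continuous_image) (auto intro: continuous_on_subset)
  then obtain H where hess_le: "0 < H" "\<And>w. w \<in> cball 0 R \<Longrightarrow> norm (hess F w) \<le> H"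
    unfolding bounded_pos by force
  have "(16 * H)-lipschitz_on (cball 0 R) (grad F)"
  proof (rule bounded_derivative_imp_lipschitz)
    fix w assume w: "w \<in> cball (0::real^4) R"
    show "(grad F has_derivative (\<lambda>h. hess F w *v h)) (at w within cball 0 R)"
      using C2_R4_has_derivative(2)[OF F] has_derivative_at_withinI by blast
    have "\<bar>hess F w $ i $ j\<bar> \<le> H" for i j
      using component_le_norm_cart[of "hess F w $ i" j] Finite_Cartesian_Product.norm_nth_le[of "hess F w" i]
        hess_le(2)[OF w]
      by linarith
    then show "onorm (\<lambda>h. hess F w *v h) \<le> 16 * H"
      using onorm_le_matrix_component[of "hess F w" H] by simp
  qed (use hess_le in auto)
  then show ?thesis
    by blast
qed

lemma superquadratic_grad:
  assumes F: "C2_R4 F" "F 0 = 0" and p: "0 < p"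
    and Euler: "\<And>w. (p + 2) * Gfun F w \<le> w \<bullet> grad (Gfun F) w"
  shows "superquadratic F (grad F) p"
proof
  show "F 0 = 0" "0 < p"
    by fact+
  show "(F has_derivative (\<lambda>h. grad F w \<bullet> h)) (at w)" for w
    by (rule C2_R4_has_derivative(1)[OF F(1)])
  show "\<exists>C. C-lipschitz_on (cball 0 R) (grad F)" for R
    by (rule C2_R4_grad_Lipschitz[OF F(1)])
  show "t powr (p + 2) * (w \<bullet> grad F w) \<le> (t *\<^sub>R w) \<bullet> grad F (t *\<^sub>R w)" if "1 \<le> t" for t w
    using powr_scaling_if_Euler_inequality[OF C2_R4_has_derivative(3)[OF F(1)] Euler that]
    unfolding Gfun_def .
qed

section \<open>Minimisers are critical points\<close>

locale boussinesq = superquadratic F "grad F" p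
  for F :: "real^4 \<Rightarrow> real" and p :: real +
  fixes a a2 c c2 b b2 \<omega> :: real
  assumes b_pos: "b > 0" "b2 > 0"
    and \<omega>_less: "\<bar>\<omega>\<bar> < Min {1, -a / b, -c / b, a2 / b2, c2 / b2}"
begin

abbreviation "B \<equiv> qform a a2 c c2 b b2 \<omega>"
abbreviation "I \<equiv> Iw a a2 c c2 b b2 \<omega>"
abbreviation "J \<equiv> Jw a a2 c c2 b b2 \<omega> F"
abbreviation "P \<equiv> Pw a a2 c c2 b b2 \<omega> F"

definition first_variation :: "(real \<Rightarrow> real) \<Rightarrow> (real \<Rightarrow> real) \<Rightarrow> (real \<Rightarrow> real) \<Rightarrow> (real \<Rightarrow> real) \<Rightarrow> real" where
  "first_variation \<psi> v h k = (LINT x|lborel. B (jet \<psi> v x) (jet h k x))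
     - (LINT x|lborel. grad F (fst (jet \<psi> v x)) \<bullet> fst (jet h k x))"

lemma G_eq_Gfun: "G = Gfun F"
  by (simp add: G_def Gfun_def fun_eq_iff)

lemma J_eq_energy: "J \<psi> v = energy lborel (I \<psi> v) (\<lambda>x. fst (jet \<psi> v x))"
  by (simp add: Jw_def Kfun_def energy_def jet_def)

lemma P_eq: "P \<psi> v = I \<psi> v - (LINT x|lborel. G (fst (jet \<psi> v x)))"
  by (simp add: Pw_def Nfun_def G_eq_Gfun jet_def)

lemma B_nonneg: "0 \<le> B z z" and B_eq_0_iff: "B z z = 0 \<longleftrightarrow> z = 0"
  using qform_positive_definite[OF b_pos \<omega>_less] by auto

lemma I_nonneg:
  assumes "H2 \<psi>" "H2 v"
  shows "0 \<le> I \<psi> v"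
  unfolding Iw_eq_integral_qform[OF assms] by (intro integral_nonneg_AE AE_I2 B_nonneg)

lemma I_eq_0_iff:
  assumes "H2 \<psi>" "H2 v"
  shows "I \<psi> v = 0 \<longleftrightarrow> (AE x in lborel. jet \<psi> v x = 0)"
proof -
  have "I \<psi> v = 0 \<longleftrightarrow> (AE x in lborel. B (jet \<psi> v x) (jet \<psi> v x) = 0)"
    unfolding Iw_eq_integral_qform[OF assms] using square_integrable_jet[OF assms] B_nonneg
    by (intro integral_nonneg_eq_0_iff_AE integrable_bounded_bilinear[OF bounded_bilinear_qform]) auto
  then show ?thesis
    by (simp add: B_eq_0_iff)
qed

context
  fixes \<psi> v h k :: "real \<Rightarrow> real"
  assumes in_H2: "H2 \<psi>" "H2 v" "H2 h" "H2 k"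
begin

lemma I_lincomb:
  "I (\<lambda>x. \<alpha> * \<psi> x + \<beta> * h x) (\<lambda>x. \<alpha> * v x + \<beta> * k x) = \<alpha>\<^sup>2 * I \<psi> v
    + 2 * (\<alpha> * \<beta>) * (LINT x|lborel. B (jet \<psi> v x) (jet h k x)) + \<beta>\<^sup>2 * I h k"
proof -
  have "(\<lambda>z. B z z) \<in> borel_measurable borel"
    by (intro borel_measurable_continuous_onI bounded_bilinear.continuous_on[OF bounded_bilinear_qform]
        continuous_intros)
  from integral_jet_lincomb[OF this in_H2] show ?thesis
    using integral_quadratic_lincomb[OF bounded_bilinear_qform qform_sym
        square_integrable_jet[OF in_H2(1,2)] square_integrable_jet[OF in_H2(3,4)]] in_H2
    by (simp add: Iw_eq_integral_qform H2_lincomb(1))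
qed

lemma integral_jet_fst_lincomb:
  assumes "continuous_on UNIV f"
  shows "(LINT x|lborel. f (fst (jet (\<lambda>x. \<alpha> * \<psi> x + \<beta> * h x) (\<lambda>x. \<alpha> * v x + \<beta> * k x) x)))
    = (LINT x|lborel. f (\<alpha> *\<^sub>R fst (jet \<psi> v x) + \<beta> *\<^sub>R fst (jet h k x)) :: real)"
proof -
  have "(\<lambda>z::(real^4) \<times> real \<times> real. f (fst z)) \<in> borel_measurable borel"
    by (intro borel_measurable_continuous_onI continuous_on_compose2[OF assms] continuous_intros) auto
  from integral_jet_lincomb[OF this in_H2, of \<alpha> \<beta>] show ?thesis
    by simp
qed

lemma J_lincomb:
  "J (\<lambda>x. \<alpha> * \<psi> x + \<beta> * h x) (\<lambda>x. \<alpha> * v x + \<beta> * k x)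
    = energy lborel (I (\<lambda>x. \<alpha> * \<psi> x + \<beta> * h x) (\<lambda>x. \<alpha> * v x + \<beta> * k x))
        (\<lambda>x. \<alpha> *\<^sub>R fst (jet \<psi> v x) + \<beta> *\<^sub>R fst (jet h k x))"
  by (simp add: J_eq_energy energy_def integral_jet_fst_lincomb[OF F_continuous])

lemma P_lincomb:
  "P (\<lambda>x. \<alpha> * \<psi> x + \<beta> * h x) (\<lambda>x. \<alpha> * v x + \<beta> * k x)
    = I (\<lambda>x. \<alpha> * \<psi> x + \<beta> * h x) (\<lambda>x. \<alpha> * v x + \<beta> * k x)
      - (LINT x|lborel. G (\<alpha> *\<^sub>R fst (jet \<psi> v x) + \<beta> *\<^sub>R fst (jet h k x)))"
  using quadratically_bounded_G unfolding quadratically_bounded_def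
  by (simp add: P_eq integral_jet_fst_lincomb)

end

lemma Sw_le:
  assumes in_H2: "H2 \<psi>" "H2 v" and "P \<psi> v = 0" "\<not> X_zero \<psi> v"
  shows "Sw a a2 c c2 b b2 \<omega> F \<le> J \<psi> v"
  unfolding Sw_def
proof (rule cInf_lower)
  have "0 \<le> J \<phi> u" if "H2 \<phi>" "H2 u" "P \<phi> u = 0" for \<phi> u
    using energy_nonneg[OF bounded_square_integrable_jet_fst[OF that(1,2)]] I_nonneg[OF that(1,2)] that(3)
    by (simp add: J_eq_energy P_eq)
  then show "bdd_below {J \<psi> v |\<psi> v. H2 \<psi> \<and> H2 v \<and> P \<psi> v = 0 \<and> \<not> X_zero \<psi> v}"
    by (intro bdd_belowI[of _ 0]) auto
qed (use assms in blast)

lemma first_variation_eq_0_if_I_eq_0: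
  assumes \<psi>v: "H2 \<psi>" "H2 v" and "I \<psi> v = 0"
  shows "first_variation \<psi> v h k = 0"
proof -
  have "AE x in lborel. jet \<psi> v x = 0"
    using assms(3) I_eq_0_iff[OF \<psi>v] by simp
  then have "AE x in lborel. B (jet \<psi> v x) (jet h k x) = 0"
    "AE x in lborel. grad F (fst (jet \<psi> v x)) \<bullet> fst (jet h k x) = 0"
    by (eventually_elim; simp add: qform_def DF_0 case_prod_unfold)+
  then show ?thesis
    unfolding first_variation_def by (simp add: integral_eq_zero_AE)
qed

lemma first_variation_eq_0_at_minimiser:
  assumes \<psi>v: "H2 \<psi>" "H2 v" and P: "P \<psi> v = 0" and J: "J \<psi> v = Sw a a2 c c2 b b2 \<omega> F"
    and hk: "H2 h" "H2 k"
  shows "first_variation \<psi> v h k = 0"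
proof (cases "I \<psi> v = 0")
  case True
  with \<psi>v show ?thesis
    by (rule first_variation_eq_0_if_I_eq_0)
next
  case False
  let ?W = "\<lambda>x. fst (jet \<psi> v x)" and ?V = "\<lambda>x. fst (jet h k x)"
  define D where "D = (LINT x|lborel. B (jet \<psi> v x) (jet h k x))"
  define Q where "Q s = I \<psi> v + 2 * s * D + s\<^sup>2 * I h k" for s
  have G_eq: "(LINT x|lborel. G (?W x)) = I \<psi> v"
    using P by (simp add: P_eq)
  have "(LINT x|lborel. grad F (?W x) \<bullet> ?V x) = D"
  proof (rule nehari_minimiser_first_variation_eq)
    show "bounded_square_integrable lborel ?W" "bounded_square_integrable lborel ?V"
      by (intro bounded_square_integrable_jet_fst \<psi>v hk)+
    show "0 < (LINT x|lborel. G (?W x))"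
      using False I_nonneg[OF \<psi>v] G_eq by simp
    show "Q 0 = (LINT x|lborel. G (?W x))"
      by (simp add: Q_def G_eq)
    show "(Q has_real_derivative 2 * D) (at 0)"
      unfolding Q_def[abs_def] by (auto intro!: derivative_eq_intros)
    fix t s :: real assume t: "0 < t" and Q_pos: "0 < Q s"
      and on_nehari: "t\<^sup>2 * Q s = (LINT x|lborel. G (t *\<^sub>R ?W x + (t * s) *\<^sub>R ?V x))"
    let ?\<phi> = "\<lambda>x. t * \<psi> x + (t * s) * h x" and ?u = "\<lambda>x. t * v x + (t * s) * k x"
    have \<phi>u: "H2 ?\<phi>" "H2 ?u"
      using \<psi>v hk by (simp_all only: H2_lincomb(1))
    have I_eq: "I ?\<phi> ?u = t\<^sup>2 * Q s"
      unfolding I_lincomb[OF \<psi>v hk] by (simp add: Q_def D_def power2_eq_square algebra_simps)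
    have "P ?\<phi> ?u = 0"
      unfolding P_lincomb[OF \<psi>v hk] I_eq using on_nehari by simp
    moreover have "\<not> X_zero ?\<phi> ?u"
      using jet_AE_eq_0[OF \<phi>u] I_eq_0_iff[OF \<phi>u] t Q_pos unfolding I_eq by auto
    ultimately have "J \<psi> v \<le> J ?\<phi> ?u"
      unfolding J by (rule Sw_le[OF \<phi>u])
    then show "energy lborel (Q 0) ?W \<le> energy lborel (t\<^sup>2 * Q s) (\<lambda>x. t *\<^sub>R ?W x + (t * s) *\<^sub>R ?V x)"
      unfolding J_lincomb[OF \<psi>v hk] I_eq by (simp add: J_eq_energy Q_def)
  qed
  then show ?thesis
    by (simp add: first_variation_def D_def)
qed

lemma I_le_X_norm_sq:
  obtains K where "0 \<le> K" "\<And>h k. H2 h \<Longrightarrow> H2 k \<Longrightarrow> \<bar>I h k\<bar> \<le> K * (X_norm h k)\<^sup>2"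
proof -
  obtain K where B_le: "0 \<le> K" "\<And>z y. norm (B z y) \<le> norm z * norm y * K"
    using bounded_bilinear.nonneg_bounded[OF bounded_bilinear_qform] by blast
  show thesis
  proof (rule that[OF B_le(1)])
    fix h k assume hk: "H2 h" "H2 k"
    have "I h k \<le> (LINT x|lborel. K * (norm (jet h k x))\<^sup>2)"
      unfolding Iw_eq_integral_qform[OF hk]
    proof (rule integral_mono)
      show "integrable lborel (\<lambda>x. B (jet h k x) (jet h k x))"
        using square_integrable_jet[OF hk] by (intro integrable_bounded_bilinear[OF bounded_bilinear_qform])
      show "integrable lborel (\<lambda>x. K * (norm (jet h k x))\<^sup>2)"
        using square_integrable_jet[OF hk] by (simp add: square_integrable_norm_sq)
      show "B (jet h k x) (jet h k x) \<le> K * (norm (jet h k x))\<^sup>2" for x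
        using B_le(2)[of "jet h k x" "jet h k x"] by (simp add: power2_eq_square mult_ac)
    qed
    then show "\<bar>I h k\<bar> \<le> K * (X_norm h k)\<^sup>2"
      using I_nonneg[OF hk] by (simp add: integral_norm_jet_sq[OF hk])
  qed
qed

lemma J_linearisation:
  assumes \<psi>v: "H2 \<psi>" "H2 v"
  obtains C where "0 \<le> C" "\<And>h k. H2 h \<Longrightarrow> H2 k \<Longrightarrow> X_norm h k < 1 \<Longrightarrow>
    \<bar>J (\<lambda>x. \<psi> x + h x) (\<lambda>x. v x + k x) - J \<psi> v - first_variation \<psi> v h k\<bar> \<le> C * (X_norm h k)\<^sup>2"
proof -
  let ?W = "\<lambda>x. fst (jet \<psi> v x)"
  note W = bounded_square_integrable_jet_fst[OF \<psi>v]
  obtain R where W_le: "AE x in lborel. norm (?W x) \<le> R"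
    using bounded_square_integrable_bound[OF W] by blast
  obtain K where I_le: "0 \<le> K" "\<And>h k. H2 h \<Longrightarrow> H2 k \<Longrightarrow> \<bar>I h k\<bar> \<le> K * (X_norm h k)\<^sup>2"
    using I_le_X_norm_sq by blast
  obtain C where F_remainder_le: "0 \<le> C"
    "\<And>V. bounded_square_integrable lborel V \<Longrightarrow> AE x in lborel. norm (V x) \<le> max R 44 \<Longrightarrow>
      \<bar>(LINT x|lborel. F (?W x + V x)) - (LINT x|lborel. F (?W x)) - (LINT x|lborel. grad F (?W x) \<bullet> V x)\<bar>
        \<le> C * (LINT x|lborel. (norm (V x))\<^sup>2)"
  proof -
    have "AE x in lborel. norm (?W x) \<le> max R 44"
      using W_le by (auto elim: eventually_mono)
    then show thesis
      using that integral_F_linearisation[of lborel "max R 44"] W by blast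
  qed
  show thesis
  proof (rule that)
    show "0 \<le> K / 2 + C"
      using I_le(1) F_remainder_le(1) by simp
    fix h k assume hk: "H2 h" "H2 k" and small: "X_norm h k < 1"
    let ?V = "\<lambda>x. fst (jet h k x)"
    note V = bounded_square_integrable_jet_fst[OF hk]
    have "AE x in lborel. norm (?V x) \<le> max R 44"
      using jet_fst_AE_le[OF hk] small by (auto elim!: eventually_mono)
    note remainder = F_remainder_le(2)[OF V this]
    have "C * (LINT x|lborel. (norm (?V x))\<^sup>2) \<le> C * (X_norm h k)\<^sup>2"
      using integral_norm_jet_fst_sq_le[OF hk] F_remainder_le(1) by (rule mult_left_mono)
    moreover have "J (\<lambda>x. \<psi> x + h x) (\<lambda>x. v x + k x) - J \<psi> v - first_variation \<psi> v h k = I h k / 2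
        - ((LINT x|lborel. F (?W x + ?V x)) - (LINT x|lborel. F (?W x)) - (LINT x|lborel. grad F (?W x) \<bullet> ?V x))"
      using J_lincomb[OF \<psi>v hk, of 1 1] I_lincomb[OF \<psi>v hk, of 1 1]
      by (simp add: J_eq_energy energy_def first_variation_def field_simps)
    ultimately show "\<bar>J (\<lambda>x. \<psi> x + h x) (\<lambda>x. v x + k x) - J \<psi> v - first_variation \<psi> v h k\<bar>
        \<le> (K / 2 + C) * (X_norm h k)\<^sup>2"
      using remainder I_le(2)[OF hk] by (simp add: distrib_right)
  qed
qed

lemma Jw_critical_if_first_variation_eq_0:
  assumes \<psi>v: "H2 \<psi>" "H2 v" and zero: "\<And>h k. H2 h \<Longrightarrow> H2 k \<Longrightarrow> first_variation \<psi> v h k = 0"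
  shows "Jw_critical a a2 c c2 b b2 \<omega> F \<psi> v"
  unfolding Jw_critical_def
proof (intro allI impI)
  obtain C where linearisation: "0 \<le> C" "\<And>h k. H2 h \<Longrightarrow> H2 k \<Longrightarrow> X_norm h k < 1 \<Longrightarrow>
    \<bar>J (\<lambda>x. \<psi> x + h x) (\<lambda>x. v x + k x) - J \<psi> v - first_variation \<psi> v h k\<bar> \<le> C * (X_norm h k)\<^sup>2"
    using J_linearisation[OF \<psi>v] by blast
  fix \<epsilon> :: real assume \<epsilon>: "0 < \<epsilon>"
  define \<delta> where "\<delta> = min 1 (\<epsilon> / (C + 1))"
  have "\<bar>J (\<lambda>x. \<psi> x + h x) (\<lambda>x. v x + k x) - J \<psi> v\<bar> \<le> \<epsilon> * X_norm h k"
    if hk: "H2 h" "H2 k" and small: "X_norm h k < \<delta>" for h k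
  proof -
    have "(C + 1) * X_norm h k \<le> \<epsilon>"
      using small linearisation(1) by (simp add: \<delta>_def pos_less_divide_eq mult.commute)
    then have "C * X_norm h k \<le> \<epsilon>"
      using X_norm_nonneg[of h k] by (simp add: distrib_right)
    then have "C * X_norm h k * X_norm h k \<le> \<epsilon> * X_norm h k"
      using X_norm_nonneg by (rule mult_right_mono)
    then show ?thesis
      using linearisation(2)[OF hk] small zero[OF hk] by (simp add: \<delta>_def power2_eq_square mult.assoc)
  qed
  moreover have "0 < \<delta>"
    using \<epsilon> linearisation(1) by (simp add: \<delta>_def)
  ultimately show "\<exists>\<delta>>0. \<forall>h k. H2 h \<and> H2 k \<and> X_norm h k < \<delta> \<longrightarrow>
      \<bar>J (\<lambda>x. \<psi> x + h x) (\<lambda>x. v x + k x) - J \<psi> v\<bar> \<le> \<epsilon> * X_norm h k"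
    by blast
qed

end

theorem theorem2p5:
  fixes a c a2 c2 b b2 \<omega> :: real
    and F :: "real^4 \<Rightarrow> real"
    and \<psi>0 v0 :: "real \<Rightarrow> real"
  assumes "a < 0" "c < 0" "a2 > 0" "c2 > 0" "b > 0" "b2 > 0"
    and "0 < \<bar>\<omega>\<bar>"
    and "\<bar>\<omega>\<bar> < Min {1, -a / b, -c / b, a2 / b2, c2 / b2}"
    and "C2_R4 F" and "F 0 = 0"
    and cond_a: "\<exists>p>0. \<forall>w. w \<bullet> grad (Gfun F) w \<ge> (p + 2) * Gfun F w"
    and cond_b: "\<exists>q1 q2 C. 0 < q1 \<and> q1 \<le> q2 \<and> C > 0 \<and>
                   (\<forall>w. norm (hess F w) \<le> C * (norm w powr q1 + norm w powr q2))"
    and cond_c: "\<exists>u v. H2 u \<and> H2 v \<and>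
                   (LINT x|lborel. F (vec4 (u x) (wd u x) (v x) (wd v x))) > 0"
    and "H2 \<psi>0" "H2 v0"
    and "Pw a a2 c c2 b b2 \<omega> F \<psi>0 v0 = 0"
    and "Jw a a2 c c2 b b2 \<omega> F \<psi>0 v0 = Sw a a2 c c2 b b2 \<omega> F"
  shows "Jw_critical a a2 c c2 b b2 \<omega> F \<psi>0 v0"
proof -
  obtain p where p: "p > 0" "\<And>w. (p + 2) * Gfun F w \<le> w \<bullet> grad (Gfun F) w"
    using cond_a by blast
  interpret superquadratic F "grad F" p
    using \<open>C2_R4 F\<close> \<open>F 0 = 0\<close> p by (rule superquadratic_grad)
  interpret boussinesq F p a a2 c c2 b b2 \<omega>
    by unfold_locales fact+
  have "first_variation \<psi>0 v0 h k = 0" if "H2 h" "H2 k" for h k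
    using \<open>H2 \<psi>0\<close> \<open>H2 v0\<close> \<open>P \<psi>0 v0 = 0\<close> \<open>J \<psi>0 v0 = Sw a a2 c c2 b b2 \<omega> F\<close> that
    by (rule first_variation_eq_0_at_minimiser)
  with \<open>H2 \<psi>0\<close> \<open>H2 v0\<close> show ?thesis
    by (rule Jw_critical_if_first_variation_eq_0)
qed

end
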